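(* Let $(\mathsf{X},\mathcal{A},\pi)$ be a probability space, let $(\mathsf{Y},\mathcal{B})$, $(\mathsf{Z},\mathcal{C})$ be measurable spaces, and let $\tilde\pi$ be a probability measure on $\mathcal{B}\times\mathcal{C}$ with $\tilde\pi(\mathrm{d}(y,z))=\varpi_z(\mathrm{d}y)\,\varpi(\mathrm{d}z)$, where $\varpi$ is the marginal of $\tilde\pi$ on $\mathsf{Z}$. Let $T$ be a (possibly non-reversible) Markov transition kernel on $\mathsf{X}$ with $\pi T=\pi$, regarded as a bounded operator on $L_0^2(\pi)$. Assume there exist: (i) a linear transformation $P:L_0^2(\pi)\to L_0^2(\tilde\pi)$ with $\|Pf\|_{\tilde\pi}\le\|f\|_\pi$ for all $f\in L_0^2(\pi)$; (ii) Markov transition kernels $\{Q_z\}_{z\in\mathsf{Z}}$ on $\mathsf{Y}$ such that $Q_z$ is reversible with respect to $\varpi_z$ for $\varpi$-a.e. $z$, and $(y,z)\mapsto Q_z(y,\mathsf{B})$ is measurable for each $\mathsf{B}\in\mathcal{B}$; (iii) a Markov transition kernel $Q$ on $\mathsf{Y}\times\mathsf{Z}$, reversible with respect to $\tilde\pi$, and a constant $c_0\in(0,1]$ such that, for $\tilde\pi$-a.e. $(y,z)$ and every $\mathsf{B}\in\mathcal{B}$, $Q((y,z),(\mathsf{B}\setminus\{y\})\times\{z\})\ge c_0\,Q_z(y,\mathsf{B}\setminus\{y\})$; (iv) a (bounded) linear transformation $R:L_0^2(\tilde\pi)\to L_0^2(\pi)$ such that $Q=R^*R$ (as operators on $L_0^2(\tilde\pi)$)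 and $T=RP$. Suppose that there is a constant $\kappa_\dagger\in[0,1]$ such that $\mathrm{Gap}(Q_z)\ge\kappa_\dagger$ for $\varpi$-a.e. $z\in\mathsf{Z}$. Then, for every $f\in L_0^2(\pi)$, $$\|f\|_\pi^2-\|Tf\|_\pi^2\ \ge\ c_0\,\kappa_\dagger\,\mathcal{E}_{P^*E^*EP}(f).$$ Consequently, $$1-\|T\|_\pi^2\ \ge\ c_0\,\kappa_\dagger\,\mathrm{Gap}(P^*E^*EP).$$
   Context: For a probability measure $\rho$, $L_0^2(\rho)$ is the Hilbert space of real square-integrable functions with $\rho$-mean zero, with inner product $\langle\cdot,\cdot\rangle_\rho$ and norm $\|\cdot\|_\rho$; $\|\cdot\|_\rho$ also denotes the operator norm on $L_0^2(\rho)$. A Markov transition kernel $K$ with $\rho K=\rho$ acts on $L_0^2(\rho)$ by $Kf(w)=\int K(w,\mathrm{d}w')f(w')$; it is reversible iff this operator is self-adjoint. For self-adjoint $J$ on $L_0^2(\rho)$ with norm at most $1$: $\mathcal{E}_J(f)=\|f\|_\rho^2-\langle f,Jf\rangle_\rho$ and $\mathrm{Gap}(J)=\inf_{f\in L_0^2(\rho)\setminus\{0\}}\mathcal{E}_J(f)/\|f\|_\rho^2$ (presuming $L_0^2(\rho)\ne\{0\}$; a bound $\mathrm{Gap}(J)\ge\kappa$ means $\mathcal{E}_J(f)\ge\kappa\|f\|_\rho^2$ for all $f$). The gap of $Q_z$ is computed in $L_0^2(\varpi_z)$. Stars denote Hilbert-space adjoints. $E:L_0^2(\tilde\pi)\to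 L_0^2(\varpi)$ is $Eh(z)=\int_{\mathsf{Y}}h(y,z)\,\varpi_z(\mathrm{d}y)$, with adjoint $E^*g(y,z)=g(z)$. Singletons of $\mathsf{Y}$ and $\mathsf{Z}$ are understood to be measurable, so that (iii) makes sense. *)

theory Defs
  imports "HOL-Probability.Probability"
begin

section \<open>The space of centred square-integrable functions\<close>

text \<open>
  Elements of $L_0^2(M)$ are represented by functions rather than by classes modulo almost
  everywhere equality; all notions below are insensitive to the choice of representative.
  Only finite measures are of interest, and for these the square integrability of a measurable
  function implies its integrability, so that the last conjunct is a genuine mean-zero condition.
\<close>

definition L20 :: "'a measure \<Rightarrow> ('a \<Rightarrow> real) set" where
  "L20 M = {f \<in> borel_measurable M. integrable M (\<lambda>x. (f x)\<^sup>2) \<and> (\<integral>x. f x \<partial>M) = 0}"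

definition L2_inner :: "'a measure \<Rightarrow> ('a \<Rightarrow> real) \<Rightarrow> ('a \<Rightarrow> real) \<Rightarrow> real" where
  "L2_inner M f g = (\<integral>x. f x * g x \<partial>M)"

definition L2_norm :: "'a measure \<Rightarrow> ('a \<Rightarrow> real) \<Rightarrow> real" where
  "L2_norm M f = sqrt (L2_inner M f f)"

text \<open>
  A linear transformation is a map on representatives that respects almost everywhere
  equality and is linear up to almost everywhere equality.
\<close>

definition L20_linear ::
    "'a measure \<Rightarrow> 'b measure \<Rightarrow> (('a \<Rightarrow> real) \<Rightarrow> ('b \<Rightarrow> real)) \<Rightarrow> bool" where
  "L20_linear M N A \<longleftrightarrow>
     (\<forall>f\<in>L20 M. A f \<in> L20 N) \<and>
     (\<forall>f\<in>L20 M. \<forall>g\<in>L20 M. (AE x in M. f x = g x) \<longrightarrow> (AE y in N. A f y = A g y)) \<and>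
     (\<forall>f\<in>L20 M. \<forall>g\<in>L20 M. AE y in N. A (\<lambda>x. f x + g x) y = A f y + A g y) \<and>
     (\<forall>c. \<forall>f\<in>L20 M. AE y in N. A (\<lambda>x. c * f x) y = c * A f y)"

definition L20_bounded_linear ::
    "'a measure \<Rightarrow> 'b measure \<Rightarrow> (('a \<Rightarrow> real) \<Rightarrow> ('b \<Rightarrow> real)) \<Rightarrow> bool" where
  "L20_bounded_linear M N A \<longleftrightarrow>
     L20_linear M N A \<and> (\<exists>C. \<forall>f\<in>L20 M. L2_norm N (A f) \<le> C * L2_norm M f)"

definition L20_op_eq ::
    "'a measure \<Rightarrow> 'b measure \<Rightarrow> (('a \<Rightarrow> real) \<Rightarrow> ('b \<Rightarrow> real)) \<Rightarrow> (('a \<Rightarrow> real) \<Rightarrow> ('b \<Rightarrow> real)) \<Rightarrow> bool"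
  where
  "L20_op_eq M N A B \<longleftrightarrow> (\<forall>f\<in>L20 M. AE y in N. A f y = B f y)"

definition L20_is_adjoint ::
    "'a measure \<Rightarrow> 'b measure \<Rightarrow> (('a \<Rightarrow> real) \<Rightarrow> ('b \<Rightarrow> real)) \<Rightarrow> (('b \<Rightarrow> real) \<Rightarrow> ('a \<Rightarrow> real)) \<Rightarrow> bool"
  where
  "L20_is_adjoint M N A B \<longleftrightarrow>
     L20_bounded_linear N M B \<and>
     (\<forall>f\<in>L20 M. \<forall>g\<in>L20 N. L2_inner N (A f) g = L2_inner M f (B g))"

text \<open>
  For probability measures, a bounded operator has an adjoint by the Riesz representation
  theorem, and it is unique up to almost everywhere equality; the choice below only fixes
  representatives.
\<close>

definition L20_adjoint ::
    "'a measure \<Rightarrow> 'b measure \<Rightarrow> (('a \<Rightarrow> real) \<Rightarrow> ('b \<Rightarrow> real)) \<Rightarrow> (('b \<Rightarrow> real) \<Rightarrow> ('a \<Rightarrow> real))"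
  where
  "L20_adjoint M N A = (SOME B. L20_is_adjoint M N A B)"

text \<open>A supremum in the reals, hence meaningful for bounded operators only.\<close>

definition L20_op_norm ::
    "'a measure \<Rightarrow> 'b measure \<Rightarrow> (('a \<Rightarrow> real) \<Rightarrow> ('b \<Rightarrow> real)) \<Rightarrow> real" where
  "L20_op_norm M N A = (SUP f\<in>{f \<in> L20 M. L2_norm M f \<le> 1}. L2_norm N (A f))"

definition L20_nontrivial :: "'a measure \<Rightarrow> bool" where
  "L20_nontrivial M \<longleftrightarrow> (\<exists>f\<in>L20 M. L2_norm M f \<noteq> 0)"

definition dirichlet :: "'a measure \<Rightarrow> (('a \<Rightarrow> real) \<Rightarrow> ('a \<Rightarrow> real)) \<Rightarrow> ('a \<Rightarrow> real) \<Rightarrow> real" where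
  "dirichlet M J f = (L2_norm M f)\<^sup>2 - L2_inner M f (J f)"

text \<open>
  The infimum is taken in the extended reals, so that over a trivial space it is $\infty$:
  a bound \<open>ereal \<kappa> \<le> spectral_gap M J\<close> then always means
  \<open>\<kappa> * (L2_norm M f)\<^sup>2 \<le> dirichlet M J f\<close> for all \<open>f \<in> L20 M\<close> of nonzero norm.
\<close>

definition spectral_gap :: "'a measure \<Rightarrow> (('a \<Rightarrow> real) \<Rightarrow> ('a \<Rightarrow> real)) \<Rightarrow> ereal" where
  "spectral_gap M J =
     (INF f\<in>{f \<in> L20 M. L2_norm M f \<noteq> 0}. ereal (dirichlet M J f / (L2_norm M f)\<^sup>2))"

section \<open>Markov kernels\<close>

abbreviation markov_kernel :: "'a measure \<Rightarrow> ('a \<Rightarrow> 'a measure) \<Rightarrow> bool" where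
  "markov_kernel M K \<equiv> K \<in> M \<rightarrow>\<^sub>M prob_algebra M"

definition invariant_kernel :: "'a measure \<Rightarrow> ('a \<Rightarrow> 'a measure) \<Rightarrow> bool" where
  "invariant_kernel \<rho> K \<longleftrightarrow> markov_kernel \<rho> K \<and> \<rho> \<bind> K = \<rho>"

definition kernel_op :: "('a \<Rightarrow> 'a measure) \<Rightarrow> ('a \<Rightarrow> real) \<Rightarrow> ('a \<Rightarrow> real)" where
  "kernel_op K f = (\<lambda>w. \<integral>w'. f w' \<partial>K w)"

definition reversible_kernel :: "'a measure \<Rightarrow> ('a \<Rightarrow> 'a measure) \<Rightarrow> bool" where
  "reversible_kernel \<rho> K \<longleftrightarrow>
     invariant_kernel \<rho> K \<and> L20_is_adjoint \<rho> \<rho> (kernel_op K) (kernel_op K)"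

text \<open>
  \<open>disintegration Y Z \<mu> \<nu> k\<close> says that $\mu(d(y,z)) = k_z(dy)\,\nu(dz)$, where
  \<open>\<nu>\<close> is the marginal of \<open>\<mu>\<close> on the second component.
\<close>

definition disintegration ::
    "'y measure \<Rightarrow> 'z measure \<Rightarrow> ('y \<times> 'z) measure \<Rightarrow> 'z measure \<Rightarrow> ('z \<Rightarrow> 'y measure) \<Rightarrow> bool"
  where
  "disintegration Y Z \<mu> \<nu> k \<longleftrightarrow>
     \<nu> = distr \<mu> Z snd \<and>
     k \<in> Z \<rightarrow>\<^sub>M prob_algebra Y \<and>
     (\<forall>A\<in>sets (Y \<Otimes>\<^sub>M Z).
        emeasure \<mu> A = (\<integral>\<^sup>+z. (\<integral>\<^sup>+y. indicator A (y, z) \<partial>k z) \<partial>\<nu>))"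

definition fibre_mean :: "('z \<Rightarrow> 'y measure) \<Rightarrow> ('y \<times> 'z \<Rightarrow> real) \<Rightarrow> ('z \<Rightarrow> real)" where
  "fibre_mean k h = (\<lambda>z. \<integral>y. h (y, z) \<partial>k z)"

end

theory Submission
  imports Defs
begin

text \<open>
  Put $h = Pf$. Since $T = RP$ and $R^*R = Q$, we have $\|Tf\|^2 = \langle h, Qh\rangle$, so
  $\|f\|^2 - \|Tf\|^2 = \|f\|^2 - \|h\|^2 + \mathcal{E}_Q(h)$.
  By invariance, $2\mathcal{E}_Q(h)$ is the integral of the squared jumps $(h(w) - h(w'))^2$.
  Restricting it to jumps inside a fibre and using the minorization and the gaps of the $Q_z$
  bounds $\mathcal{E}_Q(h)$ below by $c_0 \kappa$ times the mean fibre variance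
  $\|h\|^2 - \|Eh\|^2$. As $\|h\| \le \|f\|$ and $c_0 \kappa \le 1$, the total is at
  least $c_0 \kappa (\|f\|^2 - \|Eh\|^2)$, and $\|Eh\|^2 = \langle f, P^*E^*EPf\rangle$.
  That the Hilbert-choice adjoints are adjoints rests on the completeness of $L_0^2$.
\<close>

section \<open>Hilbert space structure and adjoints\<close>

text \<open>The minorization says nothing about the mass that \<open>Q (y, z)\<close> and
  \<open>Qz z y\<close> leave at the current point, so the two kernels cannot be compared as
  operators. Jump forms are kept as nonnegative extended integrals, where almost everywhere
  inequalities integrate without integrability questions; the price is that nonnegativity has to be
  supplied before returning to the reals, because \<open>ennreal\<close> sends negative numbers to
  0. A fibre section of \<open>h\<close> has in general a nonzero mean, so the gap of
  \<open>Qz z\<close> controls its variance, and this is how the norm of \<open>E h\<close> enters.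
  As operators act on functions and not on classes, each use of a factorization needs measurability
  of both sides and an almost everywhere argument.\<close>

lemma integrable_mult_square_integrable:
  fixes f g :: "'a \<Rightarrow> real"
  assumes "f \<in> borel_measurable M" "g \<in> borel_measurable M"
    and "integrable M (\<lambda>x. (f x)\<^sup>2)" "integrable M (\<lambda>x. (g x)\<^sup>2)"
  shows "integrable M (\<lambda>x. f x * g x)"
proof (rule Bochner_Integration.integrable_bound)
  show "integrable M (\<lambda>x. (f x)\<^sup>2 + (g x)\<^sup>2)"
    using assms by auto
  have "\<bar>f x * g x\<bar> \<le> (f x)\<^sup>2 + (g x)\<^sup>2" for x
  proof -
    have "0 \<le> \<bar>f x\<bar> * \<bar>g x\<bar>" by simp
    moreover have "2 * \<bar>f x\<bar> * \<bar>g x\<bar> \<le> \<bar>f x\<bar>\<^sup>2 + \<bar>g x\<bar>\<^sup>2" by (rule sum_squares_bound)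
    ultimately show ?thesis unfolding abs_mult power2_abs by linarith
  qed
  then show "AE x in M. norm (f x * g x) \<le> norm ((f x)\<^sup>2 + (g x)\<^sup>2)"
    by simp
qed (use assms in measurable)

section \<open>The inner product space of centred square-integrable functions\<close>

lemma L20_measurable: "f \<in> L20 M \<Longrightarrow> f \<in> borel_measurable M"
  and L20_square_integrable: "f \<in> L20 M \<Longrightarrow> integrable M (\<lambda>x. (f x)\<^sup>2)"
  and L20_integral: "f \<in> L20 M \<Longrightarrow> (\<integral>x. f x \<partial>M) = 0"
  by (auto simp: L20_def)

lemma (in prob_space) L20_integrable:
  "f \<in> L20 M \<Longrightarrow> integrable M f"
  using square_integrable_imp_integrable[OF L20_measurable L20_square_integrable] .

lemma L20_integrable_mult: "f \<in> L20 M \<Longrightarrow> g \<in> L20 M \<Longrightarrow> integrable M (\<lambda>x. f x * g x)"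
  by (intro integrable_mult_square_integrable) (auto simp: L20_def)

lemma L20_scale: "f \<in> L20 M \<Longrightarrow> (\<lambda>x. c * f x) \<in> L20 M"
  by (auto simp: L20_def power_mult_distrib)

lemma (in prob_space) L20_add:
  assumes "f \<in> L20 M" "g \<in> L20 M"
  shows "(\<lambda>x. f x + g x) \<in> L20 M"
proof -
  have "integrable M (\<lambda>x. (f x)\<^sup>2 + (g x)\<^sup>2 + 2 * (f x * g x))"
    using assms L20_integrable_mult[OF assms] by (auto simp: L20_def)
  then show ?thesis
    using assms L20_integrable[OF assms(1)] L20_integrable[OF assms(2)]
    by (auto simp: L20_def power2_sum algebra_simps)
qed

lemma (in prob_space) L20_diff:
  "f \<in> L20 M \<Longrightarrow> g \<in> L20 M \<Longrightarrow> (\<lambda>x. f x - g x) \<in> L20 M"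
  using L20_add[OF _ L20_scale[of g M "-1"], of f] by simp

lemma L20_zero: "(\<lambda>x. 0) \<in> L20 M"
  by (simp add: L20_def)

lemma L2_inner_commute: "L2_inner M f g = L2_inner M g f"
  by (simp add: L2_inner_def mult.commute)

lemma L2_inner_add_left:
  assumes "f \<in> L20 M" "g \<in> L20 M" "h \<in> L20 M"
  shows "L2_inner M (\<lambda>x. f x + g x) h = L2_inner M f h + L2_inner M g h"
  using L20_integrable_mult[OF assms(1,3)] L20_integrable_mult[OF assms(2,3)]
  by (simp add: L2_inner_def distrib_right)

lemma L2_inner_add_right:
  assumes "f \<in> L20 M" "g \<in> L20 M" "h \<in> L20 M"
  shows "L2_inner M h (\<lambda>x. f x + g x) = L2_inner M h f + L2_inner M h g"
  using L2_inner_add_left[OF assms] by (simp add: L2_inner_commute)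

lemma L2_inner_diff_left:
  assumes "f \<in> L20 M" "g \<in> L20 M" "h \<in> L20 M"
  shows "L2_inner M (\<lambda>x. f x - g x) h = L2_inner M f h - L2_inner M g h"
  using L20_integrable_mult[OF assms(1,3)] L20_integrable_mult[OF assms(2,3)]
  by (simp add: L2_inner_def left_diff_distrib)

lemma L2_inner_diff_right:
  assumes "f \<in> L20 M" "g \<in> L20 M" "h \<in> L20 M"
  shows "L2_inner M h (\<lambda>x. f x - g x) = L2_inner M h f - L2_inner M h g"
  using L2_inner_diff_left[OF assms] by (simp add: L2_inner_commute)

lemma L2_inner_scale_left: "L2_inner M (\<lambda>x. c * f x) g = c * L2_inner M f g"
  by (simp add: L2_inner_def mult.assoc)

lemma L2_inner_scale_right: "L2_inner M f (\<lambda>x. c * g x) = c * L2_inner M f g"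
  by (simp add: L2_inner_def mult.left_commute)

lemma L2_inner_cong_AE:
  assumes "f \<in> borel_measurable M" "f' \<in> borel_measurable M"
    and "g \<in> borel_measurable M" "g' \<in> borel_measurable M"
    and "AE x in M. f x = f' x" "AE x in M. g x = g' x"
  shows "L2_inner M f g = L2_inner M f' g'"
  unfolding L2_inner_def by (rule integral_cong_AE) (use assms in auto)

lemma L2_inner_self_nonneg: "0 \<le> L2_inner M f f"
  by (simp add: L2_inner_def)

lemma L2_norm_power2: "(L2_norm M f)\<^sup>2 = L2_inner M f f"
  by (simp add: L2_norm_def L2_inner_self_nonneg)

lemma L2_norm_nonneg: "0 \<le> L2_norm M f"
  by (simp add: L2_norm_def L2_inner_self_nonneg)

lemma L2_inner_self: "L2_inner M f f = (\<integral>x. (f x)\<^sup>2 \<partial>M)"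
  by (simp add: L2_inner_def power2_eq_square)

lemma L20_norm_zero_AE:
  assumes "f \<in> L20 M" "L2_inner M f f = 0"
  shows "AE x in M. f x = 0"
  using assms integral_nonneg_eq_0_iff_AE[of M "\<lambda>x. (f x)\<^sup>2"]
  by (auto simp: L2_inner_self L20_def)

lemma (in prob_space) L2_inner_Cauchy_Schwarz_power2:
  assumes "f \<in> L20 M" "g \<in> L20 M"
  shows "(L2_inner M f g)\<^sup>2 \<le> L2_inner M f f * L2_inner M g g"
proof (cases "L2_inner M g g = 0")
  case True
  have "L2_inner M f g = L2_inner M f (\<lambda>x. 0)"
    using L20_norm_zero_AE[OF assms(2) True] assms
    by (intro L2_inner_cong_AE) (auto simp: L20_measurable)
  then show ?thesis
    by (simp add: L2_inner_def)
next
  case False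
  define a b c where "a = L2_inner M f f" and "b = L2_inner M g g" and "c = L2_inner M f g"
  \<comment> \<open>This is \<open>b\<close> times the residual of \<open>f\<close> after projection
    onto \<open>g\<close>; the scaling avoids a division.\<close>
  let ?u = "\<lambda>x. b * f x - c * g x"
  have "L2_inner M ?u ?u = b * (b * a - c * c) - c * (b * c - c * b)"
    using assms L2_inner_commute[of M g f]
    by (simp add: L2_inner_diff_left L2_inner_diff_right L2_inner_scale_left L2_inner_scale_right
        L20_scale L20_diff a_def b_def c_def)
  then have "L2_inner M ?u ?u = b * (a * b - c\<^sup>2)"
    by (simp add: power2_eq_square algebra_simps)
  then have "0 \<le> b * (a * b - c\<^sup>2)"
    using L2_inner_self_nonneg[of M ?u] by simp
  moreover have "b > 0"
    using False L2_inner_self_nonneg[of M g] by (simp add: b_def)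
  ultimately show ?thesis
    by (simp add: zero_le_mult_iff a_def b_def c_def)
qed

lemma (in prob_space) L2_inner_Cauchy_Schwarz:
  assumes "f \<in> L20 M" "g \<in> L20 M"
  shows "\<bar>L2_inner M f g\<bar> \<le> L2_norm M f * L2_norm M g"
  using real_sqrt_le_mono[OF L2_inner_Cauchy_Schwarz_power2[OF assms]]
  by (simp add: L2_norm_def real_sqrt_mult)

text \<open>Nonnegativity of the variance. It compares the L1 and L2 sizes in the completeness proof
  and later gives the conditional Jensen inequality on fibres.\<close>

lemma (in prob_space) integral_power2_le:
  fixes f :: "'a \<Rightarrow> real"
  assumes "f \<in> borel_measurable M" "integrable M (\<lambda>x. (f x)\<^sup>2)"
  shows "(\<integral>x. f x \<partial>M)\<^sup>2 \<le> (\<integral>x. (f x)\<^sup>2 \<partial>M)"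
  using variance_eq[OF square_integrable_imp_integrable[OF assms] assms(2)] variance_positive[of f]
  by simp

text \<open>The limit is taken pointwise; Fatou's lemma gives the convergence in norm.\<close>

lemma (in prob_space) L20_complete:
  assumes g: "\<And>n. g n \<in> L20 M"
    and cauchy: "\<And>m n. n \<le> m \<Longrightarrow>
      L2_inner M (\<lambda>x. g m x - g n x) (\<lambda>x. g m x - g n x) \<le> (1 / 4) ^ n"
  obtains G where "G \<in> L20 M"
    and "\<And>n. L2_inner M (\<lambda>x. g n x - G x) (\<lambda>x. g n x - G x) \<le> (1 / 4) ^ n"
proof -
  note [measurable] = L20_measurable[OF g]
  define d where "d n x = \<bar>g (Suc n) x - g n x\<bar>" for n x
  have [measurable]: "d n \<in> borel_measurable M" for n
    unfolding d_def by measurable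
  \<comment> \<open>On a probability space the L1 norm is at most the L2 norm, so the rate
    \<open>(1 / 4) ^ n\<close> of the squares makes the increments summable in L1, hence absolutely
    summable almost everywhere.\<close>
  have d_int: "(\<integral>\<^sup>+x. ennreal (d n x) \<partial>M) \<le> ennreal ((1 / 2) ^ n)" for n
  proof -
    have D: "(\<lambda>x. g (Suc n) x - g n x) \<in> L20 M"
      by (intro L20_diff g)
    have sq: "integrable M (\<lambda>x. (d n x)\<^sup>2)"
      using L20_square_integrable[OF D] by (simp add: d_def)
    have "(\<integral>x. d n x \<partial>M)\<^sup>2 \<le> (\<integral>x. (d n x)\<^sup>2 \<partial>M)"
      by (intro integral_power2_le sq) simp
    also have "\<dots> \<le> (1 / 4) ^ n"
      using cauchy[of n "Suc n"] by (simp add: L2_inner_self d_def)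
    also have "\<dots> = ((1 / 2) ^ n)\<^sup>2"
      by (simp add: power2_eq_square power_mult_distrib[symmetric])
    finally have "(\<integral>x. d n x \<partial>M) \<le> (1 / 2) ^ n"
      by (rule power2_le_imp_le) simp
    moreover have "integrable M (d n)"
      by (rule square_integrable_imp_integrable[OF _ sq]) simp
    moreover have "0 \<le> d n x" for x
      by (simp add: d_def)
    ultimately show ?thesis
      by (subst nn_integral_eq_integral) (auto intro: ennreal_leI)
  qed
  have "(\<integral>\<^sup>+x. (\<Sum>n. ennreal (d n x)) \<partial>M) = (\<Sum>n. \<integral>\<^sup>+x. ennreal (d n x) \<partial>M)"
    by (rule nn_integral_suminf) simp
  also have "\<dots> \<le> (\<Sum>n. ennreal ((1 / 2) ^ n))"
    by (intro suminf_le d_int) auto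
  also have "\<dots> = ennreal (\<Sum>n. (1 / 2) ^ n)"
    by (intro suminf_ennreal2) (auto simp: summable_geometric)
  finally have "(\<integral>\<^sup>+x. (\<Sum>n. ennreal (d n x)) \<partial>M) \<noteq> \<infinity>"
    by (auto simp: top_unique)
  then have "AE x in M. (\<Sum>n. ennreal (d n x)) \<noteq> \<infinity>"
    by (intro nn_integral_PInf_AE) auto
  then have conv: "AE x in M. convergent (\<lambda>n. g n x)"
  proof eventually_elim
    case (elim x)
    then have "summable (\<lambda>n. d n x)"
      by (intro summable_suminf_not_top) (auto simp: d_def)
    then have "summable (\<lambda>n. g (Suc n) x - g n x)"
      unfolding d_def by (rule summable_rabs_cancel)
    then have "convergent (\<lambda>n. \<Sum>i<n. g (Suc i) x - g i x)"
      by (simp add: summable_iff_convergent)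
    from convergent_add[OF this convergent_const[of "g 0 x"]] show ?case
      by (simp add: sum_lessThan_telescope[of "\<lambda>i. g i x"])
  qed
  define G where "G x = lim (\<lambda>n. g n x)" for x
  have G_meas [measurable]: "G \<in> borel_measurable M"
    unfolding G_def by measurable
  have nn: "(\<integral>\<^sup>+x. ennreal ((g n x - G x)\<^sup>2) \<partial>M) \<le> ennreal ((1 / 4) ^ n)" for n
  proof -
    \<comment> \<open>Fatou is applied in \<open>m\<close> for fixed \<open>n\<close>; the shift
      keeps the index \<open>m + n\<close> at least \<open>n\<close>, so the Cauchy bound applies to
      every term.\<close>
    have "AE x in M. ennreal ((g n x - G x)\<^sup>2)
        = liminf (\<lambda>m. ennreal ((g (m + n) x - g n x)\<^sup>2))"
      using conv
    proof eventually_elim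
      case (elim x)
      then have "(\<lambda>m. g m x) \<longlonglongrightarrow> G x"
        by (simp add: G_def convergent_LIMSEQ_iff)
      then have "(\<lambda>m. g (m + n) x) \<longlonglongrightarrow> G x"
        by (rule LIMSEQ_ignore_initial_segment)
      then have "(\<lambda>m. ennreal ((g (m + n) x - g n x)\<^sup>2)) \<longlonglongrightarrow> ennreal ((G x - g n x)\<^sup>2)"
        by (intro tendsto_ennrealI tendsto_intros)
      from lim_imp_Liminf[OF _ this] show ?case
        by (simp add: power2_commute)
    qed
    then have "(\<integral>\<^sup>+x. ennreal ((g n x - G x)\<^sup>2) \<partial>M)
        = (\<integral>\<^sup>+x. liminf (\<lambda>m. ennreal ((g (m + n) x - g n x)\<^sup>2)) \<partial>M)"
      by (rule nn_integral_cong_AE)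
    also have "\<dots> \<le> liminf (\<lambda>m. \<integral>\<^sup>+x. ennreal ((g (m + n) x - g n x)\<^sup>2) \<partial>M)"
      by (rule nn_integral_liminf) simp
    also have "\<dots> \<le> liminf (\<lambda>m. ennreal ((1 / 4) ^ n))"
    proof (intro Liminf_mono always_eventually allI)
      fix m
      have "(\<lambda>x. g (m + n) x - g n x) \<in> L20 M"
        by (intro L20_diff g)
      then show "(\<integral>\<^sup>+x. ennreal ((g (m + n) x - g n x)\<^sup>2) \<partial>M) \<le> ennreal ((1 / 4) ^ n)"
        using cauchy[of n "m + n"]
        by (subst nn_integral_eq_integral)
          (auto simp: L20_square_integrable L2_inner_self intro!: ennreal_leI)
    qed
    finally show ?thesis by (simp add: Liminf_const)
  qed
  have sq: "integrable M (\<lambda>x. (g n x - G x)\<^sup>2)" for n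
    by (rule integrableI_bounded) (use nn[of n] in \<open>auto simp: top_unique less_top[symmetric]\<close>)
  have bound: "L2_inner M (\<lambda>x. g n x - G x) (\<lambda>x. g n x - G x) \<le> (1 / 4) ^ n" for n
    using nn[of n] sq[of n] by (simp add: nn_integral_eq_integral L2_inner_self)
  have int: "integrable M (\<lambda>x. g n x - G x)" for n
    by (rule square_integrable_imp_integrable[OF _ sq]) simp
  have G_int: "integrable M G"
    using Bochner_Integration.integrable_diff[OF L20_integrable[OF g] int[of 0], of 0] by simp
  \<comment> \<open>Each \<open>g n\<close> has mean zero, so the mean of \<open>G\<close> is, up to
    sign, that of \<open>g n - G\<close>.\<close>
  have "(\<integral>x. G x \<partial>M)\<^sup>2 \<le> (1 / 4) ^ n" for n
  proof -
    have "(\<integral>x. g n x - G x \<partial>M) = - (\<integral>x. G x \<partial>M)"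
      using L20_integral[OF g[of n]] L20_integrable[OF g[of n]] G_int by simp
    then show ?thesis
      using integral_power2_le[OF _ sq[of n]] bound[of n] by (simp add: L2_inner_self)
  qed
  moreover have "(\<lambda>n. (1 / 4 :: real) ^ n) \<longlonglongrightarrow> 0"
    by (intro LIMSEQ_power_zero) simp
  ultimately have "(\<integral>x. G x \<partial>M)\<^sup>2 \<le> 0"
    by (intro LIMSEQ_le_const) auto
  moreover have "integrable M (\<lambda>x. (G x)\<^sup>2)"
  proof -
    \<comment> \<open>The expanded square of \<open>G = g 0 - (g 0 - G)\<close>, a difference of two
      square-integrable functions.\<close>
    have "integrable M (\<lambda>x. (g 0 x)\<^sup>2 + (g 0 x - G x)\<^sup>2 - 2 * (g 0 x * (g 0 x - G x)))"
      using sq[of 0] L20_square_integrable[OF g]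
      by (intro Bochner_Integration.integrable_diff Bochner_Integration.integrable_add
          integrable_mult_right integrable_mult_square_integrable) auto
    then show ?thesis
      by (simp add: power2_eq_square algebra_simps)
  qed
  ultimately have "G \<in> L20 M"
    by (simp add: L20_def)
  with bound show ?thesis using that by blast
qed

text \<open>
  The representing element minimises $\|f\|^2 - 2\varphi(f)$; minimising sequences are Cauchy by
  the parallelogram law.
\<close>

lemma (in prob_space) Riesz_representation_L20:
  fixes \<phi> :: "('a \<Rightarrow> real) \<Rightarrow> real"
  assumes add: "\<And>f g. f \<in> L20 M \<Longrightarrow> g \<in> L20 M \<Longrightarrow> \<phi> (\<lambda>x. f x + g x) = \<phi> f + \<phi> g"
    and scale: "\<And>c f. f \<in> L20 M \<Longrightarrow> \<phi> (\<lambda>x. c * f x) = c * \<phi> f"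
    and bounded: "\<And>f. f \<in> L20 M \<Longrightarrow> \<bar>\<phi> f\<bar> \<le> C * L2_norm M f"
  obtains G where "G \<in> L20 M" and "\<And>f. f \<in> L20 M \<Longrightarrow> \<phi> f = L2_inner M f G"
proof -
  define J where "J f = L2_inner M f f - 2 * \<phi> f" for f
  \<comment> \<open>Completing the square in the norm of \<open>f\<close>; this bound makes the
    infimum below finite.\<close>
  have J_ge: "- C\<^sup>2 \<le> J f" if "f \<in> L20 M" for f
  proof -
    have "2 * \<phi> f \<le> 2 * C * L2_norm M f"
      using bounded[OF that] by simp
    moreover have "0 \<le> (L2_norm M f - C)\<^sup>2" by simp
    ultimately show ?thesis
      by (simp add: J_def L2_norm_power2[symmetric] power2_diff algebra_simps)
  qed
  have bdd: "bdd_below (J ` L20 M)"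
    using J_ge by (auto intro!: bdd_belowI)
  define m where "m = (INF f\<in>L20 M. J f)"
  have m_le: "m \<le> J f" if "f \<in> L20 M" for f
    unfolding m_def using bdd that by (rule cINF_lower)
  \<comment> \<open>The parallelogram identity yields squared distance at most
    \<open>2 * \<epsilon> k + 2 * \<epsilon> n\<close>, hence at most
    \<open>4 * \<epsilon> n\<close>, which is exactly the rate that \<open>L20_complete\<close> asks
    for.\<close>
  define \<epsilon> :: "nat \<Rightarrow> real" where "\<epsilon> n = (1 / 4) ^ n / 4" for n
  have "\<exists>f\<in>L20 M. J f < m + \<epsilon> n" for n
    using cINF_less_iff[OF _ bdd, of "m + \<epsilon> n"] L20_zero[of M] by (auto simp: m_def \<epsilon>_def)
  then obtain g where g: "g n \<in> L20 M" and J_g: "J (g n) < m + \<epsilon> n" for n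
    by metis
  have cauchy: "L2_inner M (\<lambda>x. g k x - g n x) (\<lambda>x. g k x - g n x) \<le> (1 / 4) ^ n" if "n \<le> k" for n k
  proof -
    let ?s = "\<lambda>x. g k x + g n x" and ?d = "\<lambda>x. g k x - g n x"
    \<comment> \<open>The midpoint competes in the minimisation, so \<open>J h\<close> is at least
      \<open>m\<close>; this turns the parallelogram identity into an upper bound for the
      distance.\<close>
    define h where "h = (\<lambda>x. (1 / 2) * (g k x + g n x))"
    have s: "?s \<in> L20 M" and h: "h \<in> L20 M"
      unfolding h_def by (intro L20_scale L20_add g)+
    have "L2_inner M h h = L2_inner M ?s ?s / 4"
      unfolding h_def L2_inner_scale_left L2_inner_scale_right by simp
    moreover have "L2_inner M ?s ?s
        = L2_inner M (g k) (g k) + 2 * L2_inner M (g k) (g n) + L2_inner M (g n) (g n)"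
      using L2_inner_commute[of M "g n" "g k"]
      by (simp add: g L20_add L2_inner_add_left L2_inner_add_right)
    moreover have "L2_inner M ?d ?d
        = L2_inner M (g k) (g k) - 2 * L2_inner M (g k) (g n) + L2_inner M (g n) (g n)"
      using L2_inner_commute[of M "g n" "g k"]
      by (simp add: g L20_diff L2_inner_diff_left L2_inner_diff_right)
    moreover have "\<phi> h = (\<phi> (g k) + \<phi> (g n)) / 2"
      unfolding h_def scale[OF s] add[OF g g] by simp
    ultimately have "L2_inner M ?d ?d = 2 * J (g k) + 2 * J (g n) - 4 * J h"
      by (simp add: J_def)
    also have "\<dots> \<le> 2 * \<epsilon> k + 2 * \<epsilon> n"
      using J_g[of k] J_g[of n] m_le[OF h] by linarith
    also have "\<epsilon> k \<le> \<epsilon> n"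
      using that by (simp add: \<epsilon>_def power_decreasing)
    finally show ?thesis by (simp add: \<epsilon>_def)
  qed
  obtain G where G: "G \<in> L20 M"
    and lim: "\<And>n. L2_inner M (\<lambda>x. g n x - G x) (\<lambda>x. g n x - G x) \<le> (1 / 4) ^ n"
    by (rule L20_complete[of g]) (rule g, erule cauchy, rule that)
  have "\<phi> f = L2_inner M f G" if f: "f \<in> L20 M" for f
  proof -
    have "(\<lambda>n. L2_inner M (\<lambda>x. g n x - G x) f) \<longlonglongrightarrow> 0"
    proof (rule Lim_null_comparison)
      show "\<forall>\<^sub>F n in sequentially. norm (L2_inner M (\<lambda>x. g n x - G x) f) \<le> (1 / 2) ^ n * L2_norm M f"
      proof (intro always_eventually allI)
        fix n
        have "L2_norm M (\<lambda>x. g n x - G x) \<le> (1 / 2) ^ n"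
          using real_sqrt_le_mono[OF lim[of n]] by (simp add: L2_norm_def real_sqrt_power real_sqrt_divide)
        from mult_right_mono[OF this L2_norm_nonneg[of M f]]
        show "norm (L2_inner M (\<lambda>x. g n x - G x) f) \<le> (1 / 2) ^ n * L2_norm M f"
          using L2_inner_Cauchy_Schwarz[OF L20_diff[OF g[of n] G] f] by simp
      qed
      show "(\<lambda>n. (1 / 2) ^ n * L2_norm M f) \<longlonglongrightarrow> 0"
        by (intro tendsto_mult_left_zero LIMSEQ_power_zero) simp
    qed
    then have "(\<lambda>n. L2_inner M (g n) f - L2_inner M G f) \<longlonglongrightarrow> 0"
      by (simp add: L2_inner_diff_left g G f)
    then have gf: "(\<lambda>n. L2_inner M (g n) f) \<longlonglongrightarrow> L2_inner M G f"
      by (rule LIM_zero_cancel)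
    define b where "b = L2_inner M G f - \<phi> f"
    define a where "a = L2_inner M f f"
    \<comment> \<open>The first variation, taken along the minimising sequence: perturbing
      \<open>g n\<close> by \<open>t * f\<close> lowers \<open>J\<close> by less than
      \<open>\<epsilon> n\<close>. Only the inner products with \<open>f\<close> have to pass to the
      limit, so neither \<open>J\<close> nor \<open>\<phi>\<close> is evaluated along a
      limit.\<close>
    have quadratic: "0 \<le> t\<^sup>2 * a + 2 * t * b" for t
    proof -
      have step: "0 \<le> t\<^sup>2 * a + 2 * t * (L2_inner M (g n) f - \<phi> f) + \<epsilon> n" for n
      proof -
        have tf: "(\<lambda>x. t * f x) \<in> L20 M"
          by (rule L20_scale[OF f])
        have "J (\<lambda>x. g n x + t * f x)
            = J (g n) + (t\<^sup>2 * a + 2 * t * (L2_inner M (g n) f - \<phi> f))"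
          using L2_inner_commute[of M f "g n"]
          by (simp add: J_def g f tf add scale L20_add L2_inner_add_left L2_inner_add_right
              L2_inner_scale_left L2_inner_scale_right a_def power2_eq_square algebra_simps)
        then show ?thesis
          using m_le[OF L20_add[OF g[of n] tf]] J_g[of n] by simp
      qed
      have "\<epsilon> \<longlonglongrightarrow> 0"
        unfolding \<epsilon>_def by (intro tendsto_divide_zero LIMSEQ_power_zero) simp
      then have "(\<lambda>n. t\<^sup>2 * a + 2 * t * (L2_inner M (g n) f - \<phi> f) + \<epsilon> n) \<longlonglongrightarrow> t\<^sup>2 * a + 2 * t * b + 0"
        unfolding b_def by (intro tendsto_intros gf)
      then show ?thesis
        using LIMSEQ_le_const[of _ _ 0] step by fastforce
    qed
    have a: "0 \<le> a"
      unfolding a_def by (rule L2_inner_self_nonneg)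
    \<comment> \<open>The added 1 covers the case \<open>a = 0\<close>. Inserting \<open>- t\<close>
      makes the quadratic equal to minus a nonnegative multiple of the square of \<open>t\<close>,
      which forces \<open>t = 0\<close>.\<close>
    define t where "t = b / (a + 1)"
    have b: "b = (a + 1) * t"
      using a by (simp add: t_def)
    have "0 \<le> t\<^sup>2 * a - 2 * t * b"
      using quadratic[of "- t"] by simp
    also have "\<dots> = - (t\<^sup>2 * (a + 2))"
      unfolding b by (simp add: power2_eq_square algebra_simps)
    finally have "t\<^sup>2 * (a + 2) \<le> 0" by simp
    then have "t = 0"
      using a by (auto simp: mult_le_0_iff)
    then have "b = 0"
      by (simp add: b)
    then show ?thesis
      by (simp add: b_def L2_inner_commute)
  qed
  with G show ?thesis using that by blast
qed

section \<open>Uniqueness and existence of adjoints\<close>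

text \<open>Testing with \<open>u - v\<close> shows that its norm is zero. This recovers almost
  everywhere identities for an adjoint, which is known only through inner products.\<close>

lemma L20_eq_AE:
  assumes "prob_space M" "u \<in> L20 M" "v \<in> L20 M"
    and "\<And>f. f \<in> L20 M \<Longrightarrow> L2_inner M f u = L2_inner M f v"
  shows "AE x in M. u x = v x"
proof -
  interpret prob_space M by fact
  let ?w = "\<lambda>x. u x - v x"
  have w: "?w \<in> L20 M"
    by (intro L20_diff assms)
  have "L2_inner M ?w ?w = L2_inner M ?w u - L2_inner M ?w v"
    using w assms by (intro L2_inner_diff_right)
  then have "L2_inner M ?w ?w = 0"
    using assms(4)[OF w] by simp
  from L20_norm_zero_AE[OF w this] show ?thesis by simp
qed

text \<open>Riesz representation, applied to \<open>f\<close> mapped to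
  \<open>L2_inner N (A f) g\<close> for each \<open>g\<close> separately, defines
  \<open>B g\<close>. The choices for different \<open>g\<close> are unrelated; linearity of
  \<open>B\<close> and its compatibility with almost everywhere equality come from
  uniqueness.\<close>

lemma L20_adjoint_exists:
  assumes M: "prob_space M" and N: "prob_space N" and A: "L20_bounded_linear M N A"
  shows "\<exists>B. L20_is_adjoint M N A B"
proof -
  interpret M: prob_space M by fact
  interpret N: prob_space N by fact
  obtain C' where C': "\<And>f. f \<in> L20 M \<Longrightarrow> L2_norm N (A f) \<le> C' * L2_norm M f"
    using A by (auto simp: L20_bounded_linear_def)
  \<comment> \<open>The given constant may be negative if all of \<open>L20 M\<close> has norm zero;
    the bound for \<open>B\<close> needs a nonnegative one.\<close>
  define C where "C = max C' 0"
  have C_nonneg: "0 \<le> C"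
    by (simp add: C_def)
  have C: "L2_norm N (A f) \<le> C * L2_norm M f" if "f \<in> L20 M" for f
    using C'[OF that] mult_right_mono[OF _ L2_norm_nonneg, of C' C M f] by (simp add: C_def)
  have A_L20: "\<And>f. f \<in> L20 M \<Longrightarrow> A f \<in> L20 N"
    and A_add: "\<And>f g. f \<in> L20 M \<Longrightarrow> g \<in> L20 M \<Longrightarrow> AE y in N. A (\<lambda>x. f x + g x) y = A f y + A g y"
    and A_scale: "\<And>c f. f \<in> L20 M \<Longrightarrow> AE y in N. A (\<lambda>x. c * f x) y = c * A f y"
    using A by (auto simp: L20_bounded_linear_def L20_linear_def)
  have "\<exists>G. G \<in> L20 M \<and> (\<forall>f\<in>L20 M. L2_inner N (A f) g = L2_inner M f G)" if g: "g \<in> L20 N" for g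
  proof (rule M.Riesz_representation_L20[where \<phi> = "\<lambda>f. L2_inner N (A f) g" and C = "C * L2_norm N g"])
    fix f f' assume f: "f \<in> L20 M" "f' \<in> L20 M"
    then have "L2_inner N (A (\<lambda>x. f x + f' x)) g = L2_inner N (\<lambda>y. A f y + A f' y) g"
      using A_L20 g A_add[of f f']
      by (intro L2_inner_cong_AE) (auto intro!: L20_measurable M.L20_add N.L20_add)
    also have "\<dots> = L2_inner N (A f) g + L2_inner N (A f') g"
      using A_L20 f g by (intro L2_inner_add_left)
    finally show "L2_inner N (A (\<lambda>x. f x + f' x)) g = L2_inner N (A f) g + L2_inner N (A f') g" .
  next
    fix c f assume f: "f \<in> L20 M"
    then have "L2_inner N (A (\<lambda>x. c * f x)) g = L2_inner N (\<lambda>y. c * A f y) g"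
      using A_L20 g A_scale[of f c]
      by (intro L2_inner_cong_AE) (auto intro!: L20_measurable L20_scale)
    then show "L2_inner N (A (\<lambda>x. c * f x)) g = c * L2_inner N (A f) g"
      by (simp add: L2_inner_scale_left)
  next
    fix f assume f: "f \<in> L20 M"
    have "\<bar>L2_inner N (A f) g\<bar> \<le> L2_norm N (A f) * L2_norm N g"
      using f g A_L20 by (intro N.L2_inner_Cauchy_Schwarz)
    also have "\<dots> \<le> C * L2_norm M f * L2_norm N g"
      using C[OF f] by (intro mult_right_mono L2_norm_nonneg)
    finally show "\<bar>L2_inner N (A f) g\<bar> \<le> C * L2_norm N g * L2_norm M f"
      by (simp add: mult.assoc mult.commute[of "L2_norm N g"])
  qed blast
  then obtain B where B_L20: "\<And>g. g \<in> L20 N \<Longrightarrow> B g \<in> L20 M"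
    and B: "\<And>f g. g \<in> L20 N \<Longrightarrow> f \<in> L20 M \<Longrightarrow> L2_inner N (A f) g = L2_inner M f (B g)"
    by metis
  have "L20_linear N M B"
    unfolding L20_linear_def
  proof (intro conjI ballI allI impI)
    fix f assume "f \<in> L20 N" then show "B f \<in> L20 M" by (rule B_L20)
  next
    fix f g assume fg: "f \<in> L20 N" "g \<in> L20 N" and eq: "AE x in N. f x = g x"
    show "AE x in M. B f x = B g x"
    proof (rule L20_eq_AE[OF M])
      fix h assume h: "h \<in> L20 M"
      have "L2_inner N (A h) f = L2_inner N (A h) g"
        using fg eq A_L20[OF h] by (intro L2_inner_cong_AE) (auto intro: L20_measurable)
      then show "L2_inner M h (B f) = L2_inner M h (B g)"
        using B fg h by simp
    qed (use fg B_L20 in auto)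
  next
    fix f g assume fg: "f \<in> L20 N" "g \<in> L20 N"
    show "AE x in M. B (\<lambda>x. f x + g x) x = B f x + B g x"
    proof (rule L20_eq_AE[OF M])
      fix h assume h: "h \<in> L20 M"
      then show "L2_inner M h (B (\<lambda>x. f x + g x)) = L2_inner M h (\<lambda>x. B f x + B g x)"
        using fg by (simp add: B[symmetric] B_L20 A_L20 L2_inner_add_right N.L20_add)
    qed (use fg B_L20 M.L20_add N.L20_add in auto)
  next
    fix c f assume f: "f \<in> L20 N"
    show "AE x in M. B (\<lambda>x. c * f x) x = c * B f x"
    proof (rule L20_eq_AE[OF M])
      fix h assume h: "h \<in> L20 M"
      then show "L2_inner M h (B (\<lambda>x. c * f x)) = L2_inner M h (\<lambda>x. c * B f x)"
        using f by (simp add: B[symmetric] L2_inner_scale_right L20_scale)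
    qed (use f B_L20 L20_scale in auto)
  qed
  moreover have "L2_norm M (B g) \<le> C * L2_norm N g" if g: "g \<in> L20 N" for g
  proof (cases "L2_norm M (B g) = 0")
    case True
    then show ?thesis using C_nonneg by (simp add: L2_norm_nonneg)
  next
    case False
    \<comment> \<open>Adjointness with \<open>B g\<close> itself as test function; one factor of its
      norm is cancelled at the end.\<close>
    have "L2_norm M (B g) * L2_norm M (B g) = L2_inner N (A (B g)) g"
      using B[OF g B_L20[OF g]] L2_norm_power2[of M "B g"] by (simp add: power2_eq_square)
    also have "\<dots> \<le> L2_norm N (A (B g)) * L2_norm N g"
      using N.L2_inner_Cauchy_Schwarz[OF A_L20[OF B_L20[OF g]] g] by simp
    also have "\<dots> \<le> C * L2_norm M (B g) * L2_norm N g"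
      using C[OF B_L20[OF g]] by (intro mult_right_mono L2_norm_nonneg)
    finally have "L2_norm M (B g) * L2_norm M (B g) \<le> (C * L2_norm N g) * L2_norm M (B g)"
      by (simp only: mult_ac)
    moreover have "0 < L2_norm M (B g)"
      using False L2_norm_nonneg[of M "B g"] by simp
    ultimately show ?thesis by simp
  qed
  ultimately show ?thesis
    using B unfolding L20_is_adjoint_def L20_bounded_linear_def by blast
qed

lemma L20_adjoint_is_adjoint:
  assumes "prob_space M" "prob_space N" "L20_bounded_linear M N A"
  shows "L20_is_adjoint M N A (L20_adjoint M N A)"
  unfolding L20_adjoint_def using L20_adjoint_exists[OF assms] by (rule someI_ex)

section \<open>Dirichlet forms of kernels\<close>

text \<open>Tonelli for the extended integral gives a finite total, so the inner integral is finite
  for almost every \<open>x\<close>. At the exceptional points the Bochner integral has its default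
  value 0, which the outer integral does not see.\<close>

lemma integral_bind_nonneg:
  fixes u :: "'b \<Rightarrow> real"
  assumes N [measurable]: "N \<in> M \<rightarrow>\<^sub>M subprob_algebra B" and u [measurable]: "u \<in> borel_measurable B"
    and nonneg: "\<And>y. 0 \<le> u y" and int: "integrable (M \<bind> N) u"
  shows "AE x in M. integrable (N x) u"
    and "has_bochner_integral M (\<lambda>x. \<integral>y. u y \<partial>N x) (\<integral>y. u y \<partial>(M \<bind> N))"
proof -
  have u_N: "u \<in> borel_measurable (N x)" if "x \<in> space M" for x
    using that by (metis N u measurable_cong_sets sets_kernel)
  have eq: "(\<integral>\<^sup>+x. \<integral>\<^sup>+y. u y \<partial>N x \<partial>M) = ennreal (\<integral>y. u y \<partial>(M \<bind> N))"
    using nn_integral_bind[OF _ N, of "\<lambda>y. ennreal (u y)"] nn_integral_eq_integral[OF int] nonneg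
    by simp
  then have "AE x in M. (\<integral>\<^sup>+y. u y \<partial>N x) \<noteq> \<infinity>"
    by (intro nn_integral_PInf_AE) auto
  then show int_N: "AE x in M. integrable (N x) u"
    using AE_space
  proof eventually_elim
    case (elim x)
    then show ?case
      using nonneg u_N by (intro integrableI_nonneg) (auto simp: less_top[symmetric])
  qed
  show "has_bochner_integral M (\<lambda>x. \<integral>y. u y \<partial>N x) (\<integral>y. u y \<partial>(M \<bind> N))"
  proof (rule has_bochner_integral_nn_integral)
    have "(\<integral>\<^sup>+x. ennreal (\<integral>y. u y \<partial>N x) \<partial>M) = (\<integral>\<^sup>+x. \<integral>\<^sup>+y. u y \<partial>N x \<partial>M)"
      using int_N
      by (intro nn_integral_cong_AE, eventually_elim) (simp add: nn_integral_eq_integral nonneg)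
    then show "(\<integral>\<^sup>+x. ennreal (\<integral>y. u y \<partial>N x) \<partial>M) = ennreal (\<integral>y. u y \<partial>(M \<bind> N))"
      by (simp add: eq)
  qed (auto simp: nonneg integral_nonneg_AE)
qed

text \<open>Positive and negative parts are treated separately. Their inner integrals can be
  subtracted only where both are finite, hence the passage through almost everywhere equality at the
  end.\<close>

lemma integral_bind:
  fixes u :: "'b \<Rightarrow> real"
  assumes N [measurable]: "N \<in> M \<rightarrow>\<^sub>M subprob_algebra B" and u [measurable]: "u \<in> borel_measurable B"
    and int: "integrable (M \<bind> N) u"
  shows "AE x in M. integrable (N x) u"
    and "has_bochner_integral M (\<lambda>x. \<integral>y. u y \<partial>N x) (\<integral>y. u y \<partial>(M \<bind> N))"
proof -
  let ?p = "\<lambda>y. max 0 (u y)" and ?n = "\<lambda>y. max 0 (- u y)"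
  have pn: "u y = ?p y - ?n y" for y by auto
  have int_pn: "integrable (M \<bind> N) ?p" "integrable (M \<bind> N) ?n"
    using int by auto
  have p: "AE x in M. integrable (N x) ?p"
      "has_bochner_integral M (\<lambda>x. \<integral>y. ?p y \<partial>N x) (\<integral>y. ?p y \<partial>(M \<bind> N))"
    by (rule integral_bind_nonneg[OF N _ _ int_pn(1)]; simp)+
  have n: "AE x in M. integrable (N x) ?n"
      "has_bochner_integral M (\<lambda>x. \<integral>y. ?n y \<partial>N x) (\<integral>y. ?n y \<partial>(M \<bind> N))"
    by (rule integral_bind_nonneg[OF N _ _ int_pn(2)]; simp)+
  show "AE x in M. integrable (N x) u"
    using p(1) n(1)
  proof eventually_elim
    case (elim x)
    then show ?case
      using Bochner_Integration.integrable_diff[OF elim] by (simp flip: pn)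
  qed
  have "AE x in M. (\<integral>y. ?p y \<partial>N x) - (\<integral>y. ?n y \<partial>N x) = (\<integral>y. u y \<partial>N x)"
    using p(1) n(1)
  proof eventually_elim
    case (elim x)
    then show ?case
      using Bochner_Integration.integral_diff[OF elim] by (simp flip: pn)
  qed
  moreover have "(\<integral>y. ?p y \<partial>(M \<bind> N)) - (\<integral>y. ?n y \<partial>(M \<bind> N)) = (\<integral>y. u y \<partial>(M \<bind> N))"
    using Bochner_Integration.integral_diff[OF int_pn] by (simp flip: pn)
  ultimately show "has_bochner_integral M (\<lambda>x. \<integral>y. u y \<partial>N x) (\<integral>y. u y \<partial>(M \<bind> N))"
    using has_bochner_integral_diff[OF p(2) n(2)]
    by (subst (asm) has_bochner_integral_cong_AE[where g = "\<lambda>x. \<integral>y. u y \<partial>N x"]) auto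
qed

section \<open>Jump forms, fibre variances and minorization\<close>

text \<open>Expanding the square leaves the squared norm of \<open>h\<close> once from the starting
  point and, by invariance, once from the end point; the cross term is minus twice the inner product
  of \<open>h\<close> with \<open>kernel_op K h\<close>.\<close>

lemma jump_form_eq_dirichlet:
  assumes M: "prob_space M" and K: "invariant_kernel M K"
    and h: "h \<in> L20 M" and Kh: "kernel_op K h \<in> L20 M"
  shows "(\<integral>\<^sup>+x. \<integral>\<^sup>+y. ennreal ((h x - h y)\<^sup>2) \<partial>K x \<partial>M) = ennreal (2 * dirichlet M (kernel_op K) h)"
    and "0 \<le> dirichlet M (kernel_op K) h"
proof -
  interpret prob_space M by fact
  have K_prob: "K \<in> M \<rightarrow>\<^sub>M prob_algebra M" and inv: "M \<bind> K = M"
    using K by (auto simp: invariant_kernel_def)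
  note [measurable] = measurable_prob_algebraD[OF K_prob] L20_measurable[OF h]
  have sq: "integrable (M \<bind> K) (\<lambda>x. (h x)\<^sup>2)"
    using h by (simp add: inv L20_square_integrable)
  define S where "S x = (\<integral>y. (h y)\<^sup>2 \<partial>K x)" for x
  have AE_sq: "AE x in M. integrable (K x) (\<lambda>y. (h y)\<^sup>2)"
    by (rule integral_bind(1)[where B = M, OF _ _ sq]) auto
  have "has_bochner_integral M S (L2_inner M h h)"
    using integral_bind(2)[where B = M, OF _ _ sq] by (simp add: inv S_def[abs_def] L2_inner_self)
  then have S: "integrable M S" "(\<integral>x. S x \<partial>M) = L2_inner M h h"
    by (auto simp: has_bochner_integral_iff)
  \<comment> \<open>Nonnegativity is carried along because the extended integral agrees with the
    real one only for a nonnegative integrand.\<close>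
  have inner: "AE x in M. (\<integral>\<^sup>+y. ennreal ((h x - h y)\<^sup>2) \<partial>K x)
      = ennreal ((h x)\<^sup>2 - 2 * (h x * kernel_op K h x) + S x)
      \<and> 0 \<le> (h x)\<^sup>2 - 2 * (h x * kernel_op K h x) + S x"
    using AE_sq AE_space
  proof eventually_elim
    case (elim x)
    interpret Kx: prob_space "K x"
      using measurable_space[OF K_prob elim(2)] by (simp add: space_prob_algebra)
    have "sets (K x) = sets M"
      using measurable_space[OF K_prob elim(2)] by (simp add: space_prob_algebra)
    then have h_meas [measurable]: "h \<in> borel_measurable (K x)"
      using L20_measurable[OF h] by (simp cong: measurable_cong_sets)
    have h_int: "integrable (K x) h"
      by (rule Kx.square_integrable_imp_integrable[OF h_meas elim(1)])
    have expand: "(h x - h y)\<^sup>2 = (h x)\<^sup>2 - 2 * h x * h y + (h y)\<^sup>2" for y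
      by (simp add: power2_diff)
    have "integrable (K x) (\<lambda>y. (h x - h y)\<^sup>2)"
      unfolding expand using h_int elim(1) by auto
    moreover have "(\<integral>y. (h x - h y)\<^sup>2 \<partial>K x) = (h x)\<^sup>2 - 2 * (h x * kernel_op K h x) + S x"
      unfolding expand using h_int elim(1) by (simp add: S_def kernel_op_def Kx.prob_space)
    moreover have "0 \<le> (\<integral>y. (h x - h y)\<^sup>2 \<partial>K x)"
      by simp
    ultimately show ?case
      by (simp add: nn_integral_eq_integral)
  qed
  have total: "(\<integral>x. (h x)\<^sup>2 - 2 * (h x * kernel_op K h x) + S x \<partial>M) = 2 * dirichlet M (kernel_op K) h"
    using L20_square_integrable[OF h] L20_integrable_mult[OF h Kh] S
    by (simp add: dirichlet_def L2_norm_power2 L2_inner_self) (simp add: L2_inner_def)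
  have "0 \<le> (\<integral>x. (h x)\<^sup>2 - 2 * (h x * kernel_op K h x) + S x \<partial>M)"
    using inner by (intro integral_nonneg_AE) auto
  then show "0 \<le> dirichlet M (kernel_op K) h"
    by (simp add: total)
  have "(\<integral>\<^sup>+x. \<integral>\<^sup>+y. ennreal ((h x - h y)\<^sup>2) \<partial>K x \<partial>M)
      = (\<integral>\<^sup>+x. ennreal ((h x)\<^sup>2 - 2 * (h x * kernel_op K h x) + S x) \<partial>M)"
    using inner by (intro nn_integral_cong_AE) auto
  also have "\<dots> = ennreal (\<integral>x. (h x)\<^sup>2 - 2 * (h x * kernel_op K h x) + S x \<partial>M)"
    using inner L20_square_integrable[OF h] L20_integrable_mult[OF h Kh] S(1)
    by (intro nn_integral_eq_integral) auto
  finally show "(\<integral>\<^sup>+x. \<integral>\<^sup>+y. ennreal ((h x - h y)\<^sup>2) \<partial>K x \<partial>M)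
      = ennreal (2 * dirichlet M (kernel_op K) h)"
    by (simp only: total)
qed

text \<open>The infimum omits functions of norm zero; for those both sides vanish, since the
  function is zero almost everywhere.\<close>

lemma dirichlet_ge_spectral_gap:
  assumes gap: "ereal \<kappa> \<le> spectral_gap M J" and f: "f \<in> L20 M" and Jf: "J f \<in> L20 M"
  shows "\<kappa> * (L2_norm M f)\<^sup>2 \<le> dirichlet M J f"
proof (cases "L2_norm M f = 0")
  case True
  then have "AE x in M. f x = 0"
    using L20_norm_zero_AE[OF f] by (simp add: L2_norm_power2[symmetric])
  then have "L2_inner M f (J f) = L2_inner M (\<lambda>x. 0) (J f)"
    using f Jf by (intro L2_inner_cong_AE) (auto intro: L20_measurable)
  then show ?thesis
    using True by (simp add: dirichlet_def L2_inner_def)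
next
  case False
  then have "spectral_gap M J \<le> ereal (dirichlet M J f / (L2_norm M f)\<^sup>2)"
    unfolding spectral_gap_def using f by (intro INF_lower) auto
  with gap have "\<kappa> \<le> dirichlet M J f / (L2_norm M f)\<^sup>2"
    using order_trans by fastforce
  then show ?thesis
    using False by (simp add: pos_le_divide_eq)
qed

lemma reversible_kernel_op_L20:
  "reversible_kernel M K \<Longrightarrow> f \<in> L20 M \<Longrightarrow> kernel_op K f \<in> L20 M"
  by (simp add: reversible_kernel_def L20_is_adjoint_def L20_bounded_linear_def L20_linear_def)

text \<open>The Poincare inequality for functions that need not be centred: subtracting the mean
  brings \<open>u\<close> into \<open>L20 M\<close>, and the differences in the jump form do not
  notice the constant.\<close>

lemma variance_le_jump_form:
  assumes M: "prob_space M" and K: "reversible_kernel M K"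
    and gap: "ereal \<kappa> \<le> spectral_gap M (kernel_op K)"
    and u [measurable]: "u \<in> borel_measurable M" and sq: "integrable M (\<lambda>x. (u x)\<^sup>2)"
  shows "ennreal (2 * (\<kappa> * ((\<integral>x. (u x)\<^sup>2 \<partial>M) - (\<integral>x. u x \<partial>M)\<^sup>2)))
    \<le> (\<integral>\<^sup>+x. \<integral>\<^sup>+y. ennreal ((u x - u y)\<^sup>2) \<partial>K x \<partial>M)"
proof -
  interpret prob_space M by fact
  define c where "c = (\<integral>x. u x \<partial>M)"
  define h where "h x = u x - c" for x
  have u_int: "integrable M u"
    by (rule square_integrable_imp_integrable[OF u sq])
  have h_sq: "(h x)\<^sup>2 = (u x)\<^sup>2 - 2 * c * u x + c\<^sup>2" for x
    by (simp add: h_def power2_diff)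
  have h: "h \<in> L20 M"
  proof -
    have "integrable M (\<lambda>x. (h x)\<^sup>2)"
      unfolding h_sq using sq u_int by auto
    moreover have "(\<integral>x. h x \<partial>M) = 0"
      using u_int by (simp add: h_def c_def prob_space)
    ultimately show ?thesis
      by (simp add: L20_def) (simp add: h_def[abs_def])
  qed
  have "L2_inner M h h = (\<integral>x. (u x)\<^sup>2 \<partial>M) - c\<^sup>2"
    unfolding L2_inner_self h_sq using sq u_int
    by (simp add: prob_space c_def[symmetric] power2_eq_square)
  then have "\<kappa> * ((\<integral>x. (u x)\<^sup>2 \<partial>M) - c\<^sup>2) \<le> dirichlet M (kernel_op K) h"
    using dirichlet_ge_spectral_gap[OF gap h reversible_kernel_op_L20[OF K h]]
    by (simp add: L2_norm_power2)
  then have "ennreal (2 * (\<kappa> * ((\<integral>x. (u x)\<^sup>2 \<partial>M) - c\<^sup>2)))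
      \<le> (\<integral>\<^sup>+x. \<integral>\<^sup>+y. ennreal ((h x - h y)\<^sup>2) \<partial>K x \<partial>M)"
    using jump_form_eq_dirichlet(1)[OF M _ h reversible_kernel_op_L20[OF K h]] K
    by (auto simp: reversible_kernel_def intro!: ennreal_leI)
  then show ?thesis
    by (simp add: h_def c_def)
qed

text \<open>The hypothesis \<open>le\<close> is an order between two measures on \<open>Y\<close>:
  \<open>L\<close> is \<open>c\<close> times \<open>k\<close> without the point \<open>y\<close>,
  and \<open>N\<close> is the first-coordinate image of \<open>q\<close> restricted to the rest of
  the fibre. Integrals are monotone in the measure; \<open>F0\<close> removes the point
  \<open>y\<close>, and the part of \<open>q\<close> outside \<open>A\<close> contributes a
  nonnegative amount.\<close>

lemma nn_integral_minorization:
  fixes F :: "'y \<times> 'z \<Rightarrow> ennreal"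
  assumes q: "finite_measure q" "sets q = sets (Y \<Otimes>\<^sub>M Z)" and k: "finite_measure k" "sets k = sets Y"
    and y: "y \<in> space Y" "{y} \<in> sets Y" and z: "{z} \<in> sets Z" and c: "0 \<le> c"
    and F [measurable]: "F \<in> borel_measurable (Y \<Otimes>\<^sub>M Z)" and F0: "F (y, z) = 0"
    and le: "\<And>B. B \<in> sets Y \<Longrightarrow> c * measure k (B - {y}) \<le> measure q ((B - {y}) \<times> {z})"
  shows "ennreal c * (\<integral>\<^sup>+y'. F (y', z) \<partial>k) \<le> (\<integral>\<^sup>+w. F w \<partial>q)"
proof -
  interpret q: finite_measure q by fact
  interpret k: finite_measure k by fact
  note [measurable_cong] = q(2) k(2)
  have [measurable]: "{y} \<in> sets Y" "{z} \<in> sets Z" by fact+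
  have zZ: "z \<in> space Z"
    using sets.sets_into_space[OF z] by simp
  have Fz [measurable]: "(\<lambda>y'. F (y', z)) \<in> borel_measurable Y"
    using measurable_compose[OF measurable_Pair2'[OF zZ] F] by simp
  define A where "A = (space Y - {y}) \<times> {z}"
  have A [measurable]: "A \<in> sets (Y \<Otimes>\<^sub>M Z)"
    unfolding A_def by measurable
  define N where "N = distr (density q (indicator A)) Y fst"
  define L where "L = scale_measure (ennreal c) (density k (indicator (space Y - {y})))"
  have sets_LN: "sets L = sets N"
    by (simp add: L_def N_def k)
  have "L \<le> N"
  proof (rule le_measure[THEN iffD2, OF sets_LN], intro ballI)
    fix B assume "B \<in> sets L"
    then have B [measurable]: "B \<in> sets Y" by (simp add: L_def k)
    have "emeasure L B = ennreal (c * measure k (B - {y}))"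
    proof -
      have "(space Y - {y}) \<inter> B = B - {y}"
        using sets.sets_into_space[OF B] by auto
      then show ?thesis
        using c by (simp add: L_def emeasure_restricted k k.emeasure_eq_measure ennreal_mult)
    qed
    moreover have "emeasure N B = ennreal (measure q ((B - {y}) \<times> {z}))"
    proof -
      have "A \<inter> (fst -` B \<inter> space q) = (B - {y}) \<times> {z}"
        using sets.sets_into_space[OF B] zZ sets_eq_imp_space_eq[OF q(2)]
        by (auto simp: A_def space_pair_measure)
      moreover have "fst -` B \<inter> space q \<in> sets q"
        by (rule measurable_sets[of fst q Y]) auto
      ultimately show ?thesis
        by (simp add: N_def emeasure_distr emeasure_restricted q q.emeasure_eq_measure)
    qed
    ultimately show "emeasure L B \<le> emeasure N B"
      using le[OF B] by (simp add: ennreal_leI)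
  qed
  have "ennreal c * (\<integral>\<^sup>+y'. F (y', z) \<partial>k)
      = ennreal c * (\<integral>\<^sup>+y'. indicator (space Y - {y}) y' * F (y', z) \<partial>k)"
    using F0 sets_eq_imp_space_eq[OF k(2)]
    by (intro arg_cong2[where f = "(*)"] nn_integral_cong refl) (auto split: split_indicator)
  also have "\<dots> = (\<integral>\<^sup>+y'. F (y', z) \<partial>L)"
    by (simp add: L_def nn_integral_scale_measure nn_integral_density)
  also have "\<dots> \<le> (\<integral>\<^sup>+y'. F (y', z) \<partial>N)"
    by (rule nn_integral_mono_measure[OF sets_LN \<open>L \<le> N\<close>])
  also have "\<dots> = (\<integral>\<^sup>+w. indicator A w * F (fst w, z) \<partial>q)"
    by (simp add: N_def nn_integral_distr nn_integral_density)
  also have "\<dots> \<le> (\<integral>\<^sup>+w. F w \<partial>q)"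
    by (intro nn_integral_mono) (auto simp: A_def split: split_indicator)
  finally show ?thesis .
qed

section \<open>Disintegration\<close>

text \<open>Seen as a mixture of the fibre measures embedded in the product, the disintegration
  inherits Tonelli, Bochner and almost everywhere rules from the monadic bind.\<close>

lemma disintegration_as_bind:
  assumes \<mu>: "prob_space \<mu>" "sets \<mu> = sets (Y \<Otimes>\<^sub>M Z)" and dis: "disintegration Y Z \<mu> \<nu> k"
  shows "(\<lambda>z. distr (k z) (Y \<Otimes>\<^sub>M Z) (\<lambda>y. (y, z))) \<in> \<nu> \<rightarrow>\<^sub>M subprob_algebra (Y \<Otimes>\<^sub>M Z)"
    and "\<nu> \<bind> (\<lambda>z. distr (k z) (Y \<Otimes>\<^sub>M Z) (\<lambda>y. (y, z))) = \<mu>"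
proof -
  interpret prob_space \<mu> by fact
  have k [measurable]: "k \<in> Z \<rightarrow>\<^sub>M prob_algebra Y" and \<nu>: "\<nu> = distr \<mu> Z snd"
    and emeasure_\<mu>: "\<And>A. A \<in> sets (Y \<Otimes>\<^sub>M Z) \<Longrightarrow>
      emeasure \<mu> A = (\<integral>\<^sup>+z. (\<integral>\<^sup>+y. indicator A (y, z) \<partial>k z) \<partial>\<nu>)"
    using dis by (auto simp: disintegration_def)
  have sets_\<nu> [measurable_cong]: "sets \<nu> = sets Z"
    by (simp add: \<nu>)
  let ?K = "\<lambda>z. distr (k z) (Y \<Otimes>\<^sub>M Z) (\<lambda>y. (y, z))"
  show K: "?K \<in> \<nu> \<rightarrow>\<^sub>M subprob_algebra (Y \<Otimes>\<^sub>M Z)"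
    by (rule measurable_distr2[where M = Y]) (auto intro: measurable_prob_algebraD)
  have "snd \<in> \<mu> \<rightarrow>\<^sub>M Z"
    by (simp add: measurable_cong_sets[OF \<mu>(2) refl])
  \<comment> \<open>A bind over an empty space is degenerate; a probability measure excludes this
    case.\<close>
  then have ne: "space \<nu> \<noteq> {}"
    using measurable_space[of snd \<mu> Z] not_empty by (auto simp: \<nu>)
  show "\<nu> \<bind> ?K = \<mu>"
  proof (rule measure_eqI)
    show "sets (\<nu> \<bind> ?K) = sets \<mu>"
      using sets_bind[OF sets_kernel[OF K] ne] by (simp add: \<mu>)
    fix A assume "A \<in> sets (\<nu> \<bind> ?K)"
    then have A [measurable]: "A \<in> sets (Y \<Otimes>\<^sub>M Z)"
      using sets_bind[OF sets_kernel[OF K] ne] by simp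
    have "emeasure (\<nu> \<bind> ?K) A = (\<integral>\<^sup>+z. emeasure (?K z) A \<partial>\<nu>)"
      by (rule emeasure_bind[OF ne K A])
    also have "\<dots> = (\<integral>\<^sup>+z. (\<integral>\<^sup>+y. indicator A (y, z) \<partial>k z) \<partial>\<nu>)"
    proof (rule nn_integral_cong)
      fix z assume "z \<in> space \<nu>"
      then have z: "z \<in> space Z"
        using sets_eq_imp_space_eq[OF sets_\<nu>] by simp
      then have [measurable_cong]: "sets (k z) = sets Y"
        using measurable_space[OF k] by (simp add: space_prob_algebra)
      have "(\<lambda>y. (y, z)) \<in> k z \<rightarrow>\<^sub>M Y \<Otimes>\<^sub>M Z"
        using z by measurable
      then show "emeasure (?K z) A = (\<integral>\<^sup>+y. indicator A (y, z) \<partial>k z)"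
        by (subst nn_integral_indicator[symmetric], simp, subst nn_integral_distr) auto
    qed
    finally show "emeasure (\<nu> \<bind> ?K) A = emeasure \<mu> A"
      by (simp add: emeasure_\<mu>)
  qed
qed

lemma disintegration_fibre:
  assumes "disintegration Y Z \<mu> \<nu> k" "z \<in> space \<nu>"
  shows "prob_space (k z)" "sets (k z) = sets Y" "z \<in> space Z" "(\<lambda>y. (y, z)) \<in> k z \<rightarrow>\<^sub>M Y \<Otimes>\<^sub>M Z"
proof -
  show z: "z \<in> space Z"
    using assms by (auto simp: disintegration_def)
  then have "k z \<in> space (prob_algebra Y)"
    using assms by (auto simp: disintegration_def intro: measurable_space)
  then show "prob_space (k z)" and sets_k [measurable_cong]: "sets (k z) = sets Y"
    by (auto simp: space_prob_algebra)
  show "(\<lambda>y. (y, z)) \<in> k z \<rightarrow>\<^sub>M Y \<Otimes>\<^sub>M Z"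
    using z by measurable
qed

lemma disintegration_nn_integral:
  assumes \<mu>: "prob_space \<mu>" "sets \<mu> = sets (Y \<Otimes>\<^sub>M Z)" and dis: "disintegration Y Z \<mu> \<nu> k"
    and f [measurable]: "f \<in> borel_measurable (Y \<Otimes>\<^sub>M Z)"
  shows "(\<integral>\<^sup>+w. f w \<partial>\<mu>) = (\<integral>\<^sup>+z. \<integral>\<^sup>+y. f (y, z) \<partial>k z \<partial>\<nu>)"
proof -
  note K = disintegration_as_bind[OF \<mu> dis]
  have "(\<integral>\<^sup>+w. f w \<partial>\<mu>) = (\<integral>\<^sup>+z. \<integral>\<^sup>+w. f w \<partial>distr (k z) (Y \<Otimes>\<^sub>M Z) (\<lambda>y. (y, z)) \<partial>\<nu>)"
    using nn_integral_bind[OF f K(1)] by (simp add: K(2))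
  also have "\<dots> = (\<integral>\<^sup>+z. \<integral>\<^sup>+y. f (y, z) \<partial>k z \<partial>\<nu>)"
    by (intro nn_integral_cong nn_integral_distr disintegration_fibre[OF dis] f) auto
  finally show ?thesis .
qed

lemma disintegration_AE:
  assumes \<mu>: "prob_space \<mu>" "sets \<mu> = sets (Y \<Otimes>\<^sub>M Z)" and dis: "disintegration Y Z \<mu> \<nu> k"
    and P: "AE w in \<mu>. P w"
  shows "AE z in \<nu>. AE y in k z. P (y, z)"
proof -
  note K = disintegration_as_bind[OF \<mu> dis]
  \<comment> \<open>\<open>P\<close> need not be a measurable predicate (the minorization quantifies
    over all measurable sets), so a measurable null set stands in for its failure set.\<close>
  obtain N where N: "{w \<in> space \<mu>. \<not> P w} \<subseteq> N" "N \<in> null_sets \<mu>"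
    using P by (auto simp: eventually_ae_filter)
  then have [measurable]: "N \<in> sets (Y \<Otimes>\<^sub>M Z)"
    by (auto simp: \<mu> dest: null_setsD2)
  have "AE w in \<nu> \<bind> (\<lambda>z. distr (k z) (Y \<Otimes>\<^sub>M Z) (\<lambda>y. (y, z))). w \<notin> N"
    unfolding K(2) by (rule AE_not_in[OF N(2)])
  then have "AE z in \<nu>. AE w in distr (k z) (Y \<Otimes>\<^sub>M Z) (\<lambda>y. (y, z)). w \<notin> N"
    by (subst (asm) AE_bind[OF K(1)]) auto
  then show ?thesis
    using AE_space
  proof eventually_elim
    case (elim z)
    note fib = disintegration_fibre[OF dis elim(2)]
    from AE_distrD[OF fib(4) elim(1)] AE_space show ?case
    proof eventually_elim
      case (elim y)
      then have "(y, z) \<in> space \<mu>"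
        using measurable_space[OF fib(4)] sets_eq_imp_space_eq[OF \<mu>(2)] by auto
      then show ?case
        using elim N(1) by auto
    qed
  qed
qed

lemma disintegration_integral:
  fixes u :: "'y \<times> 'z \<Rightarrow> real"
  assumes \<mu>: "prob_space \<mu>" "sets \<mu> = sets (Y \<Otimes>\<^sub>M Z)" and dis: "disintegration Y Z \<mu> \<nu> k"
    and u: "integrable \<mu> u"
  shows "AE z in \<nu>. integrable (k z) (\<lambda>y. u (y, z))"
    and "has_bochner_integral \<nu> (fibre_mean k u) (\<integral>w. u w \<partial>\<mu>)"
proof -
  note K = disintegration_as_bind[OF \<mu> dis]
  have [measurable]: "u \<in> borel_measurable (Y \<Otimes>\<^sub>M Z)"
    using borel_measurable_integrable[OF u] by (simp add: measurable_cong_sets[OF \<mu>(2) refl])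
  note B = integral_bind[OF K(1) _ u[folded K(2)], unfolded K(2)]
  have "AE z in \<nu>. integrable (distr (k z) (Y \<Otimes>\<^sub>M Z) (\<lambda>y. (y, z))) u"
    by (rule B) simp
  then show "AE z in \<nu>. integrable (k z) (\<lambda>y. u (y, z))"
    using AE_space
  proof eventually_elim
    case (elim z)
    from integrable_distr[OF disintegration_fibre(4)[OF dis elim(2)] elim(1)] show ?case .
  qed
  have "has_bochner_integral \<nu> (\<lambda>z. \<integral>w. u w \<partial>distr (k z) (Y \<Otimes>\<^sub>M Z) (\<lambda>y. (y, z))) (\<integral>w. u w \<partial>\<mu>)"
    by (rule B) simp
  then show "has_bochner_integral \<nu> (fibre_mean k u) (\<integral>w. u w \<partial>\<mu>)"
  proof (rule has_bochner_integral_cong[THEN iffD1, rotated -1])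
    fix z assume z: "z \<in> space \<nu>"
    show "(\<integral>w. u w \<partial>distr (k z) (Y \<Otimes>\<^sub>M Z) (\<lambda>y. (y, z))) = fibre_mean k u z"
      unfolding fibre_mean_def by (intro integral_distr disintegration_fibre[OF dis z]) simp
  qed simp_all
qed

text \<open>Conditional Jensen: almost every fibre section is square-integrable, and its variance is
  nonnegative.\<close>

lemma fibre_mean_power2_le:
  assumes \<mu>: "prob_space \<mu>" "sets \<mu> = sets (Y \<Otimes>\<^sub>M Z)" and dis: "disintegration Y Z \<mu> \<nu> k"
    and h: "h \<in> L20 \<mu>"
  shows "AE z in \<nu>. (fibre_mean k h z)\<^sup>2 \<le> fibre_mean k (\<lambda>w. (h w)\<^sup>2) z"
  using disintegration_integral(1)[OF \<mu> dis L20_square_integrable[OF h]] AE_space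
proof eventually_elim
  case (elim z)
  note fib = disintegration_fibre[OF dis elim(2)]
  have "h \<in> borel_measurable (Y \<Otimes>\<^sub>M Z)"
    using L20_measurable[OF h] by (simp add: measurable_cong_sets[OF \<mu>(2) refl])
  then show ?case
    unfolding fibre_mean_def
    using fib(4) elim(1) by (intro prob_space.integral_power2_le[OF fib(1)]) auto
qed

lemma fibre_mean_L20:
  assumes \<mu>: "prob_space \<mu>" "sets \<mu> = sets (Y \<Otimes>\<^sub>M Z)" and dis: "disintegration Y Z \<mu> \<nu> k"
    and h: "h \<in> L20 \<mu>"
  shows "fibre_mean k h \<in> L20 \<nu>"
proof -
  interpret prob_space \<mu> by fact
  have Eh: "has_bochner_integral \<nu> (fibre_mean k h) 0"
    using disintegration_integral(2)[OF \<mu> dis L20_integrable[OF h]] by (simp add: L20_integral[OF h])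
  have sq: "integrable \<nu> (fibre_mean k (\<lambda>w. (h w)\<^sup>2))"
    using disintegration_integral(2)[OF \<mu> dis L20_square_integrable[OF h]]
    by (auto simp: has_bochner_integral_iff)
  have [measurable]: "fibre_mean k h \<in> borel_measurable \<nu>"
    using Eh by (auto simp: has_bochner_integral_iff)
  from fibre_mean_power2_le[OF \<mu> dis h] have "integrable \<nu> (\<lambda>z. (fibre_mean k h z)\<^sup>2)"
    by (intro Bochner_Integration.integrable_bound[OF sq]) (auto elim!: eventually_mono)
  with Eh show ?thesis
    by (auto simp: L20_def has_bochner_integral_iff)
qed

text \<open>\<open>fibre_mean k\<close> is conditional expectation given the second coordinate: a
  factor depending on \<open>z\<close> alone comes out of the fibre integral, and lifting along
  \<open>snd\<close> is isometric because \<open>\<nu>\<close> is the image measure.\<close>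

lemma fibre_mean_has_adjoint:
  assumes \<mu>: "prob_space \<mu>" "sets \<mu> = sets (Y \<Otimes>\<^sub>M Z)" and dis: "disintegration Y Z \<mu> \<nu> k"
  shows "L20_is_adjoint \<mu> \<nu> (fibre_mean k) (\<lambda>g w. g (snd w))"
proof -
  have \<nu>: "\<nu> = distr \<mu> Z snd"
    using dis by (simp add: disintegration_def)
  have snd [measurable]: "snd \<in> \<mu> \<rightarrow>\<^sub>M Z"
    by (simp add: measurable_cong_sets[OF \<mu>(2) refl])
  have L20: "(\<lambda>w. g (snd w)) \<in> L20 \<mu>" if "g \<in> L20 \<nu>" for g
  proof -
    have [measurable]: "g \<in> borel_measurable Z"
      using L20_measurable[OF that] by (simp add: \<nu>)
    show ?thesis
      using that by (auto simp: L20_def \<nu> integrable_distr_eq integral_distr)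
  qed
  have norm: "L2_norm \<mu> (\<lambda>w. g (snd w)) = L2_norm \<nu> g" if "g \<in> L20 \<nu>" for g
  proof -
    have [measurable]: "g \<in> borel_measurable Z"
      using L20_measurable[OF that] by (simp add: \<nu>)
    show ?thesis
      by (simp add: L2_norm_def L2_inner_def \<nu> integral_distr)
  qed
  have AE: "AE w in \<mu>. f (snd w) = g (snd w)" if "AE z in \<nu>. f z = g z" for f g :: "'b \<Rightarrow> real"
    by (rule AE_distrD[OF snd that[unfolded \<nu>]])
  have "L2_inner \<nu> (fibre_mean k h) g = L2_inner \<mu> h (\<lambda>w. g (snd w))"
    if "h \<in> L20 \<mu>" "g \<in> L20 \<nu>" for h g
    using disintegration_integral(2)[OF \<mu> dis L20_integrable_mult[OF that(1) L20[OF that(2)]]]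
    by (auto simp: has_bochner_integral_iff L2_inner_def fibre_mean_def)
  then show ?thesis
    unfolding L20_is_adjoint_def L20_bounded_linear_def L20_linear_def
    using L20 AE by (auto intro!: exI[of _ 1] simp: norm)
qed

section \<open>Comparison of the forms and of the gaps\<close>

text \<open>
  Off-diagonal mass of \<open>Q\<close> within a fibre is at least \<open>c\<close> times that of \<open>Qz\<close>; the diagonal does
  not contribute to the jump form, so the form of \<open>Q\<close> dominates the fibre forms.
\<close>

lemma dirichlet_ge_fibre_variance:
  fixes Y :: "'y measure" and Z :: "'z measure"
  assumes \<mu>: "prob_space \<mu>" "sets \<mu> = sets (Y \<Otimes>\<^sub>M Z)" and dis: "disintegration Y Z \<mu> \<nu> k"
    and single_Y: "\<And>y. y \<in> space Y \<Longrightarrow> {y} \<in> sets Y"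
    and single_Z: "\<And>z. z \<in> space Z \<Longrightarrow> {z} \<in> sets Z"
    and Q: "invariant_kernel \<mu> Q" and h: "h \<in> L20 \<mu>" and Qh: "kernel_op Q h \<in> L20 \<mu>"
    and c: "0 \<le> c" and \<kappa>: "0 \<le> \<kappa>"
    and minor: "AE (y, z) in \<mu>. \<forall>B\<in>sets Y.
      c * measure (Qz z y) (B - {y}) \<le> measure (Q (y, z)) ((B - {y}) \<times> {z})"
    and rev: "AE z in \<nu>. reversible_kernel (k z) (Qz z)"
    and gap: "AE z in \<nu>. ereal \<kappa> \<le> spectral_gap (k z) (kernel_op (Qz z))"
  shows "c * \<kappa> * (L2_inner \<mu> h h - L2_inner \<nu> (fibre_mean k h) (fibre_mean k h))
    \<le> dirichlet \<mu> (kernel_op Q) h"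
proof -
  interpret prob_space \<mu> by fact
  have Q_prob: "Q \<in> \<mu> \<rightarrow>\<^sub>M prob_algebra \<mu>"
    using Q by (simp add: invariant_kernel_def)
  note [measurable_cong] = \<mu>(2)
  note [measurable] = measurable_prob_algebraD[OF Q_prob] L20_measurable[OF h]
  have h_meas: "h \<in> borel_measurable (Y \<Otimes>\<^sub>M Z)"
    using L20_measurable[OF h] by (simp add: measurable_cong_sets[OF \<mu>(2) refl])
  define G where "G w = (\<integral>\<^sup>+w'. ennreal ((h w - h w')\<^sup>2) \<partial>Q w)" for w
  have "G \<in> borel_measurable \<mu>"
    unfolding G_def[abs_def] by (rule nn_integral_measurable_subprob_algebra2[where N = \<mu>]) measurable
  then have G_meas: "G \<in> borel_measurable (Y \<Otimes>\<^sub>M Z)"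
    by (simp add: measurable_cong_sets[OF \<mu>(2) refl])
  \<comment> \<open>Twice \<open>\<kappa>\<close> times the variance of \<open>h\<close> on the
    fibre, the form in which \<open>variance_le_jump_form\<close> delivers it.\<close>
  define V where "V z = 2 * (\<kappa> * (fibre_mean k (\<lambda>w. (h w)\<^sup>2) z - (fibre_mean k h z)\<^sup>2))" for z
  \<comment> \<open>All almost everywhere conditions are gathered at one \<open>z\<close>. There the
    minorization holds for almost every \<open>y\<close>, with a single null set for all
    \<open>B\<close>.\<close>
  have fibre: "AE z in \<nu>. ennreal (c * V z) \<le> (\<integral>\<^sup>+y. G (y, z) \<partial>k z)"
    using disintegration_AE[OF \<mu> dis minor] rev gap
      disintegration_integral(1)[OF \<mu> dis L20_square_integrable[OF h]] AE_space
  proof eventually_elim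
    case (elim z)
    note fib = disintegration_fibre[OF dis elim(5)]
    have Qz: "Qz z \<in> k z \<rightarrow>\<^sub>M prob_algebra (k z)"
      using elim(2) by (simp add: reversible_kernel_def invariant_kernel_def)
    note [measurable] = measurable_prob_algebraD[OF Qz]
    have hz [measurable]: "(\<lambda>y. h (y, z)) \<in> borel_measurable (k z)"
      using fib(4) h_meas by measurable
    have form_meas: "(\<lambda>y. \<integral>\<^sup>+y'. ennreal ((h (y, z) - h (y', z))\<^sup>2) \<partial>Qz z y) \<in> borel_measurable (k z)"
      by (rule nn_integral_measurable_subprob_algebra2[where N = "k z"]) measurable
    have "ennreal (c * V z) = ennreal c * ennreal (V z)"
      using c by (simp add: ennreal_mult')
    also have "\<dots> \<le> ennreal c * (\<integral>\<^sup>+y. \<integral>\<^sup>+y'. ennreal ((h (y, z) - h (y', z))\<^sup>2) \<partial>Qz z y \<partial>k z)"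
      using variance_le_jump_form[OF fib(1) elim(2,3) hz elim(4)]
      by (intro mult_left_mono) (auto simp: V_def fibre_mean_def)
    also have "\<dots> = (\<integral>\<^sup>+y. ennreal c * (\<integral>\<^sup>+y'. ennreal ((h (y, z) - h (y', z))\<^sup>2) \<partial>Qz z y) \<partial>k z)"
      by (rule nn_integral_cmult[symmetric, OF form_meas])
    also have "\<dots> \<le> (\<integral>\<^sup>+y. G (y, z) \<partial>k z)"
    proof (rule nn_integral_mono_AE)
      show "AE y in k z. ennreal c * (\<integral>\<^sup>+y'. ennreal ((h (y, z) - h (y', z))\<^sup>2) \<partial>Qz z y) \<le> G (y, z)"
        using elim(1) AE_space
      proof eventually_elim
        case y: (elim y)
        have "(y, z) \<in> space \<mu>"
          using measurable_space[OF fib(4) y(2)] sets_eq_imp_space_eq[OF \<mu>(2)] by simp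
        then have q: "prob_space (Q (y, z))" "sets (Q (y, z)) = sets (Y \<Otimes>\<^sub>M Z)"
          using measurable_space[OF Q_prob] by (auto simp: space_prob_algebra \<mu>(2))
        have qz: "prob_space (Qz z y)" "sets (Qz z y) = sets Y"
          using measurable_space[OF Qz y(2)] by (auto simp: space_prob_algebra fib(2))
        have yY: "y \<in> space Y"
          using y(2) sets_eq_imp_space_eq[OF fib(2)] by simp
        have F: "(\<lambda>w. ennreal ((h (y, z) - h w)\<^sup>2)) \<in> borel_measurable (Y \<Otimes>\<^sub>M Z)"
          using h_meas by measurable
        show ?case
          unfolding G_def
          using y(1)
          by (intro nn_integral_minorization[OF _ q(2) _ qz(2) yY single_Y[OF yY] single_Z[OF fib(3)] c F]
              prob_space.finite_measure q qz) auto
      qed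
    qed
    finally show ?case .
  qed
  have Eh: "fibre_mean k h \<in> L20 \<nu>"
    by (rule fibre_mean_L20[OF \<mu> dis h])
  have Eh2: "integrable \<nu> (fibre_mean k (\<lambda>w. (h w)\<^sup>2))"
      "(\<integral>z. fibre_mean k (\<lambda>w. (h w)\<^sup>2) z \<partial>\<nu>) = L2_inner \<mu> h h"
    using disintegration_integral(2)[OF \<mu> dis L20_square_integrable[OF h]]
    by (auto simp: has_bochner_integral_iff L2_inner_self)
  have V: "(\<integral>z. c * V z \<partial>\<nu>)
      = 2 * (c * \<kappa> * (L2_inner \<mu> h h - L2_inner \<nu> (fibre_mean k h) (fibre_mean k h)))"
    using Eh2 L20_square_integrable[OF Eh] by (simp add: V_def L2_inner_self)
  have V_int: "integrable \<nu> (\<lambda>z. c * V z)"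
    using Eh2 L20_square_integrable[OF Eh] by (simp add: V_def)
  have V_nonneg: "AE z in \<nu>. 0 \<le> c * V z"
    using fibre_mean_power2_le[OF \<mu> dis h] by eventually_elim (simp add: V_def c \<kappa>)
  have "ennreal (\<integral>z. c * V z \<partial>\<nu>) = (\<integral>\<^sup>+z. ennreal (c * V z) \<partial>\<nu>)"
    by (rule nn_integral_eq_integral[OF V_int V_nonneg, symmetric])
  also have "\<dots> \<le> (\<integral>\<^sup>+z. \<integral>\<^sup>+y. G (y, z) \<partial>k z \<partial>\<nu>)"
    by (rule nn_integral_mono_AE[OF fibre])
  also have "\<dots> = (\<integral>\<^sup>+w. G w \<partial>\<mu>)"
    by (rule disintegration_nn_integral[OF \<mu> dis G_meas, symmetric])
  also have "\<dots> = ennreal (2 * dirichlet \<mu> (kernel_op Q) h)"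
    unfolding G_def by (rule jump_form_eq_dirichlet(1)[OF \<mu>(1) Q h Qh])
  finally show ?thesis
    \<comment> \<open>An inequality between \<open>ennreal\<close> values descends to the reals
      because the Dirichlet form on the right is nonnegative; the common factor 2 cancels.\<close>
    using jump_form_eq_dirichlet(2)[OF \<mu>(1) Q h Qh] unfolding V by simp
qed

section \<open>From the quadratic inequality to operator norm and gap\<close>

text \<open>For a finite gap \<open>g\<close> the hypotheses give a squared norm of
  \<open>A f\<close> at most \<open>1 - c * g\<close> times that of \<open>f\<close>, and the
  supremum over the unit ball follows. The contraction bound \<open>A0\<close> settles functions of
  norm zero and the case \<open>c = 0\<close>.\<close>

lemma op_norm_power2_le_spectral_gap:
  assumes nontriv: "L20_nontrivial M" and c: "0 \<le> c"
    and A0: "\<And>f. f \<in> L20 M \<Longrightarrow> L2_norm M (A f) \<le> L2_norm M f"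
    and le: "\<And>f. f \<in> L20 M \<Longrightarrow>
      c * dirichlet M J f \<le> (L2_norm M f)\<^sup>2 - (L2_norm M (A f))\<^sup>2"
  shows "ereal c * spectral_gap M J \<le> ereal (1 - (L20_op_norm M M A)\<^sup>2)"
proof -
  let ?B = "{f \<in> L20 M. L2_norm M f \<le> 1}"
  have B_ne: "(\<lambda>x. 0) \<in> ?B"
    by (simp add: L20_zero L2_norm_def L2_inner_def)
  have norm_le: "(L20_op_norm M M A)\<^sup>2 \<le> b" if b: "\<And>f. f \<in> ?B \<Longrightarrow> (L2_norm M (A f))\<^sup>2 \<le> b" for b
  proof -
    have sqrt: "L2_norm M (A f) \<le> sqrt b" if "f \<in> ?B" for f
      using b[OF that] by (rule real_le_rsqrt)
    then have bdd: "bdd_above ((\<lambda>f. L2_norm M (A f)) ` ?B)"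
      by (intro bdd_aboveI2) auto
    have "L20_op_norm M M A \<le> sqrt b"
      unfolding L20_op_norm_def using B_ne sqrt by (intro cSUP_least) auto
    moreover have "0 \<le> L20_op_norm M M A"
      unfolding L20_op_norm_def
      using cSUP_upper[OF B_ne bdd] L2_norm_nonneg order_trans by blast
    ultimately have "(L20_op_norm M M A)\<^sup>2 \<le> (sqrt b)\<^sup>2"
      by (intro power_mono)
    moreover have "0 \<le> b"
      using b[OF B_ne] zero_le_power2 order_trans by blast
    ultimately show ?thesis by simp
  qed
  have one: "(L20_op_norm M M A)\<^sup>2 \<le> 1"
  proof (rule norm_le)
    fix f assume "f \<in> ?B"
    then have "L2_norm M (A f) \<le> 1"
      using A0[of f] by simp
    then show "(L2_norm M (A f))\<^sup>2 \<le> 1"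
      by (simp add: L2_norm_nonneg power_le_one)
  qed
  show ?thesis
  \<comment> \<open>In \<open>ereal\<close> the product of 0 with an infinite gap is 0, so here the
    claim is just \<open>one\<close>; a positive \<open>c\<close> is what settles a gap of minus
    infinity.\<close>
  proof (cases "c = 0")
    case True
    then show ?thesis using one by (simp flip: zero_ereal_def)
  next
    case False
    then have c_pos: "0 < c" using c by simp
    obtain f0 where f0: "f0 \<in> L20 M" "L2_norm M f0 \<noteq> 0"
      using nontriv by (auto simp: L20_nontrivial_def)
    have gap_le: "spectral_gap M J \<le> ereal (dirichlet M J f / (L2_norm M f)\<^sup>2)"
      if "f \<in> L20 M" "L2_norm M f \<noteq> 0" for f
      unfolding spectral_gap_def using that by (intro INF_lower) auto
    show ?thesis
    proof (cases "spectral_gap M J")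
      case (real g)
      have step: "(L2_norm M (A f))\<^sup>2 \<le> (1 - c * g) * (L2_norm M f)\<^sup>2"
        if f: "f \<in> L20 M" "L2_norm M f \<noteq> 0" for f
      proof -
        have "g * (L2_norm M f)\<^sup>2 \<le> dirichlet M J f"
          using gap_le[OF f] f(2) by (simp add: real pos_le_divide_eq)
        then have "c * (g * (L2_norm M f)\<^sup>2) \<le> c * dirichlet M J f"
          using c by (rule mult_left_mono)
        then show ?thesis
          using le[OF f(1)] by (simp add: algebra_simps)
      qed
      \<comment> \<open>Read off from \<open>f0\<close>. The sign is needed to replace the squared
        norm of \<open>f\<close> by 1 on the unit ball.\<close>
      have nonneg: "0 \<le> 1 - c * g"
      proof -
        have "0 \<le> (1 - c * g) * (L2_norm M f0)\<^sup>2"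
          using step[OF f0] zero_le_power2 order_trans by blast
        then show ?thesis
          using f0(2) by (simp add: zero_le_mult_iff)
      qed
      have "(L20_op_norm M M A)\<^sup>2 \<le> 1 - c * g"
      proof (rule norm_le)
        fix f assume f: "f \<in> ?B"
        show "(L2_norm M (A f))\<^sup>2 \<le> 1 - c * g"
        proof (cases "L2_norm M f = 0")
          case True
          then have "L2_norm M (A f) = 0"
            using A0[of f] f L2_norm_nonneg[of M "A f"] by simp
          then show ?thesis using nonneg by simp
        next
          case False
          have "(1 - c * g) * (L2_norm M f)\<^sup>2 \<le> (1 - c * g) * 1"
            using nonneg f by (intro mult_left_mono) (auto simp: L2_norm_nonneg power_le_one)
          then show ?thesis
            using step[of f] f False by simp
        qed
      qed
      then show ?thesis by (simp add: real)
    next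
      case PInf
      \<comment> \<open>The quotient of \<open>f0\<close> is a real upper bound, so nontriviality
        rules out an infinite gap.\<close>
      then show ?thesis using gap_le[OF f0] by simp
    next
      case MInf
      then show ?thesis using c_pos by simp
    qed
  qed
qed

section \<open>Factorization identities and the two bounds\<close>

theorem corollary19:
  fixes \<pi> :: "'x measure"
    and Y :: "'y measure" and Z :: "'z measure"
    and \<pi>t :: "('y \<times> 'z) measure"
    and \<omega> :: "'z measure" and \<omega>z :: "'z \<Rightarrow> 'y measure"
    and T :: "'x \<Rightarrow> 'x measure"
    and P :: "('x \<Rightarrow> real) \<Rightarrow> ('y \<times> 'z \<Rightarrow> real)"
    and Qz :: "'z \<Rightarrow> 'y \<Rightarrow> 'y measure"
    and Q :: "'y \<times> 'z \<Rightarrow> ('y \<times> 'z) measure"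
    and R :: "('y \<times> 'z \<Rightarrow> real) \<Rightarrow> ('x \<Rightarrow> real)"
    and c\<^sub>0 \<kappa> :: real
  defines "E \<equiv> fibre_mean \<omega>z"
  defines "PEEP \<equiv> L20_adjoint \<pi> \<pi>t P \<circ> L20_adjoint \<pi>t \<omega> E \<circ> E \<circ> P"
  assumes "prob_space \<pi>"
    and singletons_Y: "\<And>y. y \<in> space Y \<Longrightarrow> {y} \<in> sets Y"
    and singletons_Z: "\<And>z. z \<in> space Z \<Longrightarrow> {z} \<in> sets Z"
    and "prob_space \<pi>t" and "sets \<pi>t = sets (Y \<Otimes>\<^sub>M Z)"
    and "disintegration Y Z \<pi>t \<omega> \<omega>z"
    and "invariant_kernel \<pi> T"
    and P_linear: "L20_linear \<pi> \<pi>t P"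
    and P_contraction: "\<And>f. f \<in> L20 \<pi> \<Longrightarrow> L2_norm \<pi>t (P f) \<le> L2_norm \<pi> f"
    and Qz_kernel: "\<And>z. z \<in> space Z \<Longrightarrow> markov_kernel Y (Qz z)"
    and Qz_reversible: "AE z in \<omega>. reversible_kernel (\<omega>z z) (Qz z)"
    and Qz_measurable:
      "\<And>B. B \<in> sets Y \<Longrightarrow> (\<lambda>(y, z). measure (Qz z y) B) \<in> borel_measurable (Y \<Otimes>\<^sub>M Z)"
    and Q_reversible: "reversible_kernel \<pi>t Q"
    and "0 < c\<^sub>0" and "c\<^sub>0 \<le> 1"
    and Q_minorization:
      "AE (y, z) in \<pi>t. \<forall>B\<in>sets Y.
         measure (Q (y, z)) ((B - {y}) \<times> {z}) \<ge> c\<^sub>0 * measure (Qz z y) (B - {y})"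
    and R_linear: "L20_bounded_linear \<pi>t \<pi> R"
    and Q_factor: "L20_op_eq \<pi>t \<pi>t (kernel_op Q) (L20_adjoint \<pi>t \<pi> R \<circ> R)"
    and T_factor: "L20_op_eq \<pi> \<pi> (kernel_op T) (R \<circ> P)"
    and "0 \<le> \<kappa>" and "\<kappa> \<le> 1"
    and Qz_gap: "AE z in \<omega>. spectral_gap (\<omega>z z) (kernel_op (Qz z)) \<ge> ereal \<kappa>"
  shows "(\<forall>f\<in>L20 \<pi>.
            (L2_norm \<pi> f)\<^sup>2 - (L2_norm \<pi> (kernel_op T f))\<^sup>2 \<ge> c\<^sub>0 * \<kappa> * dirichlet \<pi> PEEP f) \<and>
         (L20_nontrivial \<pi> \<longrightarrow>
            ereal (1 - (L20_op_norm \<pi> \<pi> (kernel_op T))\<^sup>2) \<ge>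
              ereal (c\<^sub>0 * \<kappa>) * spectral_gap \<pi> PEEP)"
proof -
  interpret \<pi>: prob_space \<pi> by fact
  interpret \<pi>t: prob_space \<pi>t by fact
  note \<mu> = \<open>prob_space \<pi>t\<close> \<open>sets \<pi>t = sets (Y \<Otimes>\<^sub>M Z)\<close>
  note dis = \<open>disintegration Y Z \<pi>t \<omega> \<omega>z\<close>
  have P_bounded: "L20_bounded_linear \<pi> \<pi>t P"
    unfolding L20_bounded_linear_def using P_linear P_contraction by (auto intro!: exI[of _ 1])
  note P_adj = L20_adjoint_is_adjoint[OF \<open>prob_space \<pi>\<close> \<mu>(1) P_bounded]
  note R_adj = L20_adjoint_is_adjoint[OF \<mu>(1) \<open>prob_space \<pi>\<close> R_linear]
  \<comment> \<open>The explicit adjoint only witnesses existence; the chosen one may differ from it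
    in its representatives, and what follows uses the adjoint property alone.\<close>
  have "\<exists>B. L20_is_adjoint \<pi>t \<omega> E B"
    unfolding E_def using fibre_mean_has_adjoint[OF \<mu> dis] by blast
  then have E_adj: "L20_is_adjoint \<pi>t \<omega> E (L20_adjoint \<pi>t \<omega> E)"
    unfolding L20_adjoint_def by (rule someI_ex)
  have P_L20: "P f \<in> L20 \<pi>t" if "f \<in> L20 \<pi>" for f
    using P_linear that by (simp add: L20_linear_def)
  have R_L20: "R h \<in> L20 \<pi>" if "h \<in> L20 \<pi>t" for h
    using R_linear that by (simp add: L20_bounded_linear_def L20_linear_def)
  have PEEP: "L2_inner \<pi> f (PEEP f) = L2_inner \<omega> (E (P f)) (E (P f))" if f: "f \<in> L20 \<pi>" for f
  proof -
    have EP: "E (P f) \<in> L20 \<omega>"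
      unfolding E_def by (rule fibre_mean_L20[OF \<mu> dis P_L20[OF f]])
    then have "L20_adjoint \<pi>t \<omega> E (E (P f)) \<in> L20 \<pi>t"
      using E_adj by (simp add: L20_is_adjoint_def L20_bounded_linear_def L20_linear_def)
    then have "L2_inner \<pi> f (PEEP f) = L2_inner \<pi>t (P f) (L20_adjoint \<pi>t \<omega> E (E (P f)))"
      using P_adj f by (simp add: PEEP_def L20_is_adjoint_def)
    also have "\<dots> = L2_inner \<omega> (E (P f)) (E (P f))"
      using E_adj EP P_L20[OF f] by (simp add: L20_is_adjoint_def)
    finally show ?thesis .
  qed
  have T_norm: "(L2_norm \<pi> (kernel_op T f))\<^sup>2 = L2_inner \<pi>t (P f) (kernel_op Q (P f))"
    if f: "f \<in> L20 \<pi>" for f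
  proof -
    have T: "T \<in> \<pi> \<rightarrow>\<^sub>M subprob_algebra \<pi>" "\<pi> \<bind> T = \<pi>"
      using \<open>invariant_kernel \<pi> T\<close> by (auto simp: invariant_kernel_def intro: measurable_prob_algebraD)
    \<comment> \<open>Agreement almost everywhere with \<open>R (P f)\<close> would not by itself
      give measurability, as \<open>\<pi>\<close> need not be complete; it comes from
      \<open>T\<close> being an invariant kernel.\<close>
    have "kernel_op T f \<in> borel_measurable \<pi>"
      using integral_bind(2)[OF T(1) L20_measurable[OF f]] \<pi>.L20_integrable[OF f]
      by (auto simp: T(2) kernel_op_def[abs_def] has_bochner_integral_iff)
    then have "L2_inner \<pi> (kernel_op T f) (kernel_op T f) = L2_inner \<pi> (R (P f)) (R (P f))"
      using T_factor f R_L20[OF P_L20[OF f]]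
      by (intro L2_inner_cong_AE) (auto simp: L20_op_eq_def L20_measurable)
    also have "\<dots> = L2_inner \<pi>t (P f) (L20_adjoint \<pi>t \<pi> R (R (P f)))"
      using R_adj P_L20[OF f] R_L20[OF P_L20[OF f]] by (simp add: L20_is_adjoint_def)
    also have "\<dots> = L2_inner \<pi>t (P f) (kernel_op Q (P f))"
    proof (rule L2_inner_cong_AE)
      show "L20_adjoint \<pi>t \<pi> R (R (P f)) \<in> borel_measurable \<pi>t"
        using R_adj R_L20[OF P_L20[OF f]]
        by (auto simp: L20_is_adjoint_def L20_bounded_linear_def L20_linear_def intro: L20_measurable)
      show "AE w in \<pi>t. L20_adjoint \<pi>t \<pi> R (R (P f)) w = kernel_op Q (P f) w"
        using Q_factor P_L20[OF f] by (auto simp: L20_op_eq_def elim!: eventually_mono)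
    qed (use P_L20[OF f] reversible_kernel_op_L20[OF Q_reversible] in \<open>auto intro: L20_measurable\<close>)
    finally show ?thesis by (simp add: L2_norm_power2)
  qed
  have Q_inv: "invariant_kernel \<pi>t Q"
    using Q_reversible by (simp add: reversible_kernel_def)
  have P_norm: "L2_inner \<pi>t (P f) (P f) \<le> L2_inner \<pi> f f" if f: "f \<in> L20 \<pi>" for f
    using power_mono[OF P_contraction[OF f] L2_norm_nonneg, of 2] by (simp add: L2_norm_power2)
  have main: "c\<^sub>0 * \<kappa> * dirichlet \<pi> PEEP f \<le> (L2_norm \<pi> f)\<^sup>2 - (L2_norm \<pi> (kernel_op T f))\<^sup>2"
    if f: "f \<in> L20 \<pi>" for f
  proof -
    let ?h = "P f"
    have "c\<^sub>0 * \<kappa> * (L2_inner \<pi>t ?h ?h - L2_inner \<omega> (E ?h) (E ?h)) \<le> dirichlet \<pi>t (kernel_op Q) ?h"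
      unfolding E_def
      using \<open>0 < c\<^sub>0\<close> Q_minorization
      by (intro dirichlet_ge_fibre_variance[OF \<mu> dis singletons_Y singletons_Z Q_inv P_L20[OF f]
            reversible_kernel_op_L20[OF Q_reversible P_L20[OF f]] _ \<open>0 \<le> \<kappa>\<close> _ Qz_reversible Qz_gap])
        auto
    \<comment> \<open>Added to the previous inequality, this replaces the squared norm of
      \<open>P f\<close> by that of \<open>f\<close> on both sides.\<close>
    moreover have "0 \<le> (1 - c\<^sub>0 * \<kappa>) * (L2_inner \<pi> f f - L2_inner \<pi>t ?h ?h)"
      using P_norm[OF f] \<open>0 < c\<^sub>0\<close> \<open>c\<^sub>0 \<le> 1\<close> \<open>0 \<le> \<kappa>\<close> \<open>\<kappa> \<le> 1\<close> by (simp add: mult_le_one)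
    ultimately show ?thesis
      unfolding dirichlet_def PEEP[OF f] T_norm[OF f] unfolding L2_norm_power2
      by (simp add: algebra_simps)
  qed
  \<comment> \<open>The squared norm of \<open>kernel_op T f\<close> is that of \<open>P f\<close>
    minus the Dirichlet form of \<open>Q\<close>, which is nonnegative as half an integral of
    squares.\<close>
  have T_contraction: "L2_norm \<pi> (kernel_op T f) \<le> L2_norm \<pi> f" if f: "f \<in> L20 \<pi>" for f
  proof (rule power2_le_imp_le[OF _ L2_norm_nonneg])
    have "0 \<le> dirichlet \<pi>t (kernel_op Q) (P f)"
      by (rule jump_form_eq_dirichlet(2)[OF \<mu>(1) Q_inv P_L20[OF f]
            reversible_kernel_op_L20[OF Q_reversible P_L20[OF f]]])
    then show "(L2_norm \<pi> (kernel_op T f))\<^sup>2 \<le> (L2_norm \<pi> f)\<^sup>2"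
      using P_norm[OF f] unfolding dirichlet_def T_norm[OF f] unfolding L2_norm_power2
      by simp
  qed
  show ?thesis
    using main op_norm_power2_le_spectral_gap[where c = "c\<^sub>0 * \<kappa>", OF _ _ T_contraction main]
      \<open>0 < c\<^sub>0\<close> \<open>0 \<le> \<kappa>\<close> by auto
qed

end
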